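(* Let $X\subseteq\mathbb{R}^d$ be compact, let $\Omega\subseteq\mathbb{R}^{d}\times\mathbb{R}$ be closed, with elements written $w=(v,b)$, and let $\sigma:\mathbb{R}\to\mathbb{R}$ be continuous. Assume that either $\Omega$ is compact or $\sigma(y)\in O(y)$ (at most linear growth). Let $\mathcal{B}_\sigma$ be the Barron space on $X$ with weight set $\Omega$, and let $\mathcal{F}(X,\Omega)$ be the integral RKBS defined by the kernel $$\varphi(x,w)=(1+\|v\|_1+|b|)^{-1}\,\sigma(v^Tx+b),\qquad w=(v,b).$$ Then $\mathcal{B}_\sigma\cong\mathcal{F}(X,\Omega)$, i.e. the two spaces are isometrically isomorphic.
   Context: $\mathcal{P}(S)$ denotes the Borel probability measures on $S$; $\mathcal{M}(\Omega)$ denotes the Banach space of signed, finite, regular Borel (Radon) measures on $\Omega$ with total variation norm $\|\mu\|_{\mathcal{M}(\Omega)}=|\mu|(\Omega)$. $\Omega$ carries the subspace topology. Barron space. For $\pi\in\mathcal{P}(\mathbb{R}\times\Omega)$ put $(A\pi)(x)=\int_{\mathbb{R}\times\Omega}a\,\sigma(v^Tx+b)\,d\pi(a,v,b)$, $x\in X$. The Barron space $\mathcal{B}_\sigma$ consists of the functions $f:X\to\mathbb{R}$ of the form $f=A\pi$ for some $\pi\in\mathcal{P}(\mathbb{R}\times\Omega)$ for which $\int|a|(1+\|v\|_1+|b|)\,d\pi(a,v,b)<\infty$, with norm $$\|f\|_{\mathcal{B}_\sigma}:=\inf_{\pi:\,f=A\pi}\int_{\mathbb{R}\times\Omega}|a|(1+\|v\|_1+|b|)\,d\pi(a,v,b).$$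 Integral RKBS. For a kernel $\varphi:X\times\Omega\to\mathbb{R}$ and $\mu\in\mathcal{M}(\Omega)$ put $(A\mu)(x)=\int_\Omega\varphi(x,w)\,d\mu(w)$. Then $\mathcal{F}(X,\Omega):=\{f:X\to\mathbb{R}\mid \exists\mu\in\mathcal{M}(\Omega),\ f=A\mu\}$ with norm $\|f\|_{\mathcal{F}(X,\Omega)}:=\inf_{f=A\mu}\|\mu\|_{\mathcal{M}(\Omega)}$. $\sigma(y)\in O(y)$ means $|\sigma(y)|=O(|y|)$ as $|y|\to\infty$. *)

theory Defs
  imports "HOL-Analysis.Analysis" "HOL-Probability.Probability" "HOL-Library.Landau_Symbols"
begin

text \<open>
  A function on a set \<open>X\<close> is represented by an element of \<^term>\<open>extensional X\<close>; hence vector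
  space operations on such functions are followed by restriction to \<open>X\<close>.
\<close>

definition normed_function_space ::
    "'x set \<Rightarrow> ('x \<Rightarrow> real) set \<Rightarrow> (('x \<Rightarrow> real) \<Rightarrow> real) \<Rightarrow> bool" where
  "normed_function_space X V N \<longleftrightarrow>
     V \<subseteq> extensional X \<and>
     (\<lambda>x\<in>X. 0) \<in> V \<and>
     (\<forall>f\<in>V. \<forall>g\<in>V. (\<lambda>x\<in>X. f x + g x) \<in> V \<and> N (\<lambda>x\<in>X. f x + g x) \<le> N f + N g) \<and>
     (\<forall>c. \<forall>f\<in>V. (\<lambda>x\<in>X. c * f x) \<in> V \<and> N (\<lambda>x\<in>X. c * f x) = \<bar>c\<bar> * N f) \<and>
     (\<forall>f\<in>V. N f = 0 \<longleftrightarrow> f = (\<lambda>x\<in>X. 0))"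

definition isometrically_isomorphic ::
    "'x set \<Rightarrow> ('x \<Rightarrow> real) set \<Rightarrow> (('x \<Rightarrow> real) \<Rightarrow> real) \<Rightarrow>
       ('x \<Rightarrow> real) set \<Rightarrow> (('x \<Rightarrow> real) \<Rightarrow> real) \<Rightarrow> bool" where
  "isometrically_isomorphic X V N W N' \<longleftrightarrow>
     normed_function_space X V N \<and>
     normed_function_space X W N' \<and>
     (\<exists>T. bij_betw T V W \<and>
          (\<forall>f\<in>V. \<forall>g\<in>V. T (\<lambda>x\<in>X. f x + g x) = (\<lambda>x\<in>X. T f x + T g x)) \<and>
          (\<forall>c. \<forall>f\<in>V. T (\<lambda>x\<in>X. c * f x) = (\<lambda>x\<in>X. c * T f x)) \<and>
          (\<forall>f\<in>V. N' (T f) = N f))"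

abbreviation borel_on :: "'a::topological_space set \<Rightarrow> 'a measure" where
  "borel_on S \<equiv> restrict_space borel S"

definition borel_prob_measures :: "'a::topological_space set \<Rightarrow> 'a measure set" where
  "borel_prob_measures S = {\<pi>. prob_space \<pi> \<and> sets \<pi> = sets (borel_on S)}"


subsection \<open>Signed Radon measures\<close>

text \<open>
  A signed measure on \<open>\<Omega>\<close> is a real-valued set function; its values outside the Borel sets of
  \<open>\<Omega>\<close> are irrelevant.
\<close>

definition total_variation ::
    "'a::topological_space set \<Rightarrow> ('a set \<Rightarrow> real) \<Rightarrow> 'a set \<Rightarrow> ennreal" where
  "total_variation \<Omega> \<mu> A =
     (SUP P\<in>{P. finite P \<and> P \<subseteq> sets (borel_on \<Omega>) \<and> partition_on A P}.
        \<Sum>B\<in>P. ennreal \<bar>\<mu> B\<bar>)"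

definition signed_radon_measures :: "'a::topological_space set \<Rightarrow> ('a set \<Rightarrow> real) set" where
  "signed_radon_measures \<Omega> =
     {\<mu>. \<mu> {} = 0 \<and>
         (\<forall>A. range A \<subseteq> sets (borel_on \<Omega>) \<longrightarrow> disjoint_family A \<longrightarrow>
            (\<lambda>i::nat. \<mu> (A i)) sums \<mu> (\<Union>i. A i)) \<and>
         total_variation \<Omega> \<mu> \<Omega> < \<infinity> \<and>
         (\<forall>A\<in>sets (borel_on \<Omega>).
            total_variation \<Omega> \<mu> A =
              (SUP K\<in>{K. K \<subseteq> A \<and> compact K}. total_variation \<Omega> \<mu> K) \<and>
            total_variation \<Omega> \<mu> A =
              (INF U\<in>{U. A \<subseteq> U \<and> openin (top_of_set \<Omega>) U}. total_variation \<Omega> \<mu> U))}"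

definition variation_norm :: "'a::topological_space set \<Rightarrow> ('a set \<Rightarrow> real) \<Rightarrow> real" where
  "variation_norm \<Omega> \<mu> = enn2real (total_variation \<Omega> \<mu> \<Omega>)"

text \<open>
  Integration against a signed measure is by the Jordan decomposition, with positive and negative
  parts \<open>(\<bar>\<mu>\<bar> + \<mu>) / 2\<close> and \<open>(\<bar>\<mu>\<bar> - \<mu>) / 2\<close>.
\<close>

definition positive_part :: "'a::topological_space set \<Rightarrow> ('a set \<Rightarrow> real) \<Rightarrow> 'a measure" where
  "positive_part \<Omega> \<mu> =
     measure_of \<Omega> (sets (borel_on \<Omega>))
       (\<lambda>A. ennreal ((enn2real (total_variation \<Omega> \<mu> A) + \<mu> A) / 2))"

definition negative_part :: "'a::topological_space set \<Rightarrow> ('a set \<Rightarrow> real) \<Rightarrow> 'a measure" where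
  "negative_part \<Omega> \<mu> =
     measure_of \<Omega> (sets (borel_on \<Omega>))
       (\<lambda>A. ennreal ((enn2real (total_variation \<Omega> \<mu> A) - \<mu> A) / 2))"

definition signed_integral ::
    "'a::topological_space set \<Rightarrow> ('a set \<Rightarrow> real) \<Rightarrow> ('a \<Rightarrow> real) \<Rightarrow> real" where
  "signed_integral \<Omega> \<mu> f =
     (\<integral>w. f w \<partial>positive_part \<Omega> \<mu>) - (\<integral>w. f w \<partial>negative_part \<Omega> \<mu>)"


subsection \<open>Integral reproducing kernel Banach spaces\<close>

definition rkbs_map ::
    "'x set \<Rightarrow> 'w::topological_space set \<Rightarrow> ('x \<Rightarrow> 'w \<Rightarrow> real) \<Rightarrow> ('w set \<Rightarrow> real) \<Rightarrow> 'x \<Rightarrow> real" where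
  "rkbs_map X \<Omega> \<phi> \<mu> = (\<lambda>x\<in>X. signed_integral \<Omega> \<mu> (\<phi> x))"

definition rkbs ::
    "'x set \<Rightarrow> 'w::topological_space set \<Rightarrow> ('x \<Rightarrow> 'w \<Rightarrow> real) \<Rightarrow> ('x \<Rightarrow> real) set" where
  "rkbs X \<Omega> \<phi> = {f. \<exists>\<mu>\<in>signed_radon_measures \<Omega>. f = rkbs_map X \<Omega> \<phi> \<mu>}"

definition rkbs_norm ::
    "'x set \<Rightarrow> 'w::topological_space set \<Rightarrow> ('x \<Rightarrow> 'w \<Rightarrow> real) \<Rightarrow> ('x \<Rightarrow> real) \<Rightarrow> real" where
  "rkbs_norm X \<Omega> \<phi> f =
     (INF \<mu>\<in>{\<mu> \<in> signed_radon_measures \<Omega>. f = rkbs_map X \<Omega> \<phi> \<mu>}. variation_norm \<Omega> \<mu>)"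


subsection \<open>Barron spaces\<close>

definition l1_norm :: "real^'d \<Rightarrow> real" where
  "l1_norm v = (\<Sum>i\<in>UNIV. \<bar>v $ i\<bar>)"

definition barron_integrand :: "real \<times> (real^'d) \<times> real \<Rightarrow> real" where
  "barron_integrand = (\<lambda>(a, v, b). \<bar>a\<bar> * (1 + l1_norm v + \<bar>b\<bar>))"

definition barron_measures ::
    "((real^'d) \<times> real) set \<Rightarrow> (real \<times> (real^'d) \<times> real) measure set" where
  "barron_measures \<Omega> =
     {\<pi> \<in> borel_prob_measures (UNIV \<times> \<Omega>). integrable \<pi> barron_integrand}"

definition barron_map ::
    "(real^'d) set \<Rightarrow> (real \<Rightarrow> real) \<Rightarrow> (real \<times> (real^'d) \<times> real) measure \<Rightarrow> real^'d \<Rightarrow> real" where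
  "barron_map X \<sigma> \<pi> = (\<lambda>x\<in>X. \<integral>(a, v, b). a * \<sigma> (v \<bullet> x + b) \<partial>\<pi>)"

definition barron_space ::
    "(real^'d) set \<Rightarrow> ((real^'d) \<times> real) set \<Rightarrow> (real \<Rightarrow> real) \<Rightarrow> (real^'d \<Rightarrow> real) set" where
  "barron_space X \<Omega> \<sigma> = {f. \<exists>\<pi>\<in>barron_measures \<Omega>. f = barron_map X \<sigma> \<pi>}"

text \<open>
  Measures for which the integral below is infinite do not contribute to the infimum over all
  probability measures representing an element of the Barron space. They are left out because
  the Bochner integral of a non-integrable function is \<open>0\<close>.
\<close>

definition barron_norm ::
    "(real^'d) set \<Rightarrow> ((real^'d) \<times> real) set \<Rightarrow> (real \<Rightarrow> real) \<Rightarrow> (real^'d \<Rightarrow> real) \<Rightarrow> real" where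
  "barron_norm X \<Omega> \<sigma> f =
     (INF \<pi>\<in>{\<pi> \<in> barron_measures \<Omega>. f = barron_map X \<sigma> \<pi>}. \<integral>z. barron_integrand z \<partial>\<pi>)"

definition barron_kernel :: "(real \<Rightarrow> real) \<Rightarrow> real^'d \<Rightarrow> (real^'d) \<times> real \<Rightarrow> real" where
  "barron_kernel \<sigma> x = (\<lambda>(v, b). inverse (1 + l1_norm v + \<bar>b\<bar>) * \<sigma> (v \<bullet> x + b))"

end

theory Submission imports Defs begin

text \<open>
  Both spaces consist of the functions \<open>\<integral>\<phi> dP - \<integral>\<phi> dN\<close> with \<open>P\<close> and \<open>N\<close> finite Borel measures on \<open>\<Omega>\<close>,
  and both norms are the infimum of \<open>P \<Omega> + N \<Omega>\<close> over all such representations, so the identity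
  is the isometry.  A signed measure \<open>\<mu>\<close> gives such a pair by its Jordan decomposition;
  conversely \<open>P - N\<close> is a signed measure of total variation at most \<open>P \<Omega> + N \<Omega>\<close>, and it is
  Radon because \<open>\<Omega>\<close> is Polish.  For the Barron space, with weight \<open>h (v, b) = 1 + \<parallel>v\<parallel>\<^sub>1 + \<bar>b\<bar>\<close>, a
  measure \<open>\<pi>\<close> gives the images under \<open>(a, w) \<mapsto> w\<close> of the densities \<open>a\<^sup>+ h\<close> and \<open>a\<^sup>- h\<close>; conversely, with
  \<open>m = P \<Omega> + N \<Omega>\<close>, the images of \<open>P / m\<close> and \<open>N / m\<close> under \<open>w \<mapsto> (\<plusminus>m / h w, w)\<close> add up to a
  probability measure.  No integrability is lost since the growth condition on \<open>\<sigma>\<close> makes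
  \<open>\<phi> x\<close> bounded on \<open>\<Omega>\<close> for every \<open>x\<close>.
\<close>

subsection \<open>Sums of measures and finite Borel measures\<close>

text \<open>Only \<open>M\<close> supplies the space and the sigma-algebra. The formula is meant for
  \<open>N\<close> with the same measurable sets, which the lemmas on its values assume.\<close>

definition add_measure :: "'a measure \<Rightarrow> 'a measure \<Rightarrow> 'a measure" where
  "add_measure M N = measure_of (space M) (sets M) (\<lambda>A. emeasure M A + emeasure N A)"

lemma sets_add_measure [simp, measurable_cong]: "sets (add_measure M N) = sets M"
  by (simp add: add_measure_def)

lemma space_add_measure [simp]: "space (add_measure M N) = space M"
  by (simp add: add_measure_def)

lemma emeasure_add_measure:
  assumes "sets N = sets M" "A \<in> sets M"
  shows "emeasure (add_measure M N) A = emeasure M A + emeasure N A"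
  unfolding add_measure_def
proof (rule emeasure_measure_of_sigma)
  show "sigma_algebra (space M) (sets M)" ..
  show "positive (sets M) (\<lambda>A. emeasure M A + emeasure N A)"
    by (simp add: positive_def)
  show "countably_additive (sets M) (\<lambda>A. emeasure M A + emeasure N A)"
    unfolding countably_additive_def
    using assms(1) by (simp add: suminf_add[symmetric] suminf_emeasure)
qed fact

lemma nn_integral_add_measure:
  assumes sets: "sets N = sets M" and f: "f \<in> borel_measurable M"
  shows "(\<integral>\<^sup>+x. f x \<partial>add_measure M N) = (\<integral>\<^sup>+x. f x \<partial>M) + (\<integral>\<^sup>+x. f x \<partial>N)"
  using f
proof (induction rule: borel_measurable_induct)
  case (cong f g)
  then show ?case
    using sets_eq_imp_space_eq[OF sets]
    by (metis nn_integral_cong space_add_measure)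
next
  case (set A)
  then show ?case
    by (simp add: sets emeasure_add_measure)
next
  case (mult u c)
  moreover have "u \<in> borel_measurable N" "u \<in> borel_measurable (add_measure M N)"
    using mult.hyps(2) by (simp_all add: measurable_cong_sets[OF sets refl] measurable_cong_sets[OF sets_add_measure refl])
  ultimately show ?case
    by (simp add: nn_integral_cmult distrib_left)
next
  case (add u v)
  moreover have "u \<in> borel_measurable N" "u \<in> borel_measurable (add_measure M N)"
    "v \<in> borel_measurable N" "v \<in> borel_measurable (add_measure M N)"
    using add.hyps by (simp_all add: measurable_cong_sets[OF sets refl] measurable_cong_sets[OF sets_add_measure refl])
  ultimately show ?case
    by (simp add: nn_integral_add algebra_simps)
next
  case (seq U)
  have m: "U i \<in> borel_measurable M" "U i \<in> borel_measurable N" "U i \<in> borel_measurable (add_measure M N)" for i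
    using seq.hyps by (simp_all add: measurable_cong_sets[OF sets refl] measurable_cong_sets[OF sets_add_measure refl])
  \<comment> \<open>Both sequences of integrals increase, so the supremum of their sums is the sum
    of their suprema.\<close>
  have inc: "incseq (\<lambda>i. integral\<^sup>N L (U i))" for L
    using seq.hyps(3) by (auto simp: incseq_def le_fun_def intro!: nn_integral_mono)
  show ?case
    unfolding SUP_apply
    by (simp add: nn_integral_monotone_convergence_SUP[OF seq.hyps(3)] m seq.IH ennreal_SUP_add inc)
qed

lemma
  fixes f :: "'a \<Rightarrow> real"
  assumes sets: "sets N = sets M" and M: "integrable M f" and N: "integrable N f"
  shows integrable_add_measure: "integrable (add_measure M N) f"
    and integral_add_measure:
      "(\<integral>x. f x \<partial>add_measure M N) = (\<integral>x. f x \<partial>M) + (\<integral>x. f x \<partial>N)"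
proof -
  have f[measurable]: "f \<in> borel_measurable M"
    using M by simp
  have nn: "(\<integral>\<^sup>+x. ennreal (g x) \<partial>add_measure M N) = (\<integral>\<^sup>+x. ennreal (g x) \<partial>M) + (\<integral>\<^sup>+x. ennreal (g x) \<partial>N)"
    if "g \<in> borel_measurable M" for g
    using that by (intro nn_integral_add_measure sets) simp
  show I: "integrable (add_measure M N) f"
    using M N by (simp add: integrable_iff_bounded nn measurable_cong_sets[OF sets_add_measure refl])
  \<comment> \<open>Since \<open>ennreal\<close> cuts off negative values, this bounds the integral
    of the positive part. Used for \<open>f\<close> and \<open>- f\<close>, it lets
    \<open>enn2real\<close> distribute over the sums.\<close>
  have fin: "(\<integral>\<^sup>+x. ennreal (g x) \<partial>L) < \<top>" if "integrable L g" for L g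
    using that le_less_trans[OF nn_integral_mono[of L "\<lambda>x. ennreal (g x)" "\<lambda>x. ennreal (norm (g x))"]]
    by (auto simp: integrable_iff_bounded ennreal_leI)
  show "(\<integral>x. f x \<partial>add_measure M N) = (\<integral>x. f x \<partial>M) + (\<integral>x. f x \<partial>N)"
    using M N fin[OF M] fin[OF N] fin[OF integrable_minus[OF M]] fin[OF integrable_minus[OF N]]
    by (simp add: real_lebesgue_integral_def I nn enn2real_plus)
qed

section \<open>Finite Borel measures on a set\<close>

definition finite_borel_measures :: "'a::topological_space set \<Rightarrow> 'a measure set" where
  "finite_borel_measures S = {M. finite_measure M \<and> sets M = sets (borel_on S)}"

lemma space_finite_borel_measures: "M \<in> finite_borel_measures S \<Longrightarrow> space M = S"
  using sets_eq_imp_space_eq[of M "borel_on S"] by (simp add: finite_borel_measures_def space_restrict_space)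

lemma add_measure_finite_borel:
  assumes "M \<in> finite_borel_measures S" "N \<in> finite_borel_measures S"
  shows "add_measure M N \<in> finite_borel_measures S"
    "measure (add_measure M N) S = measure M S + measure N S"
proof -
  interpret M: finite_measure M using assms by (simp add: finite_borel_measures_def)
  interpret N: finite_measure N using assms by (simp add: finite_borel_measures_def)
  have s: "sets N = sets M" "S \<in> sets M"
    using assms space_finite_borel_measures[OF assms(1)] sets.top[of M] by (auto simp: finite_borel_measures_def)
  show "add_measure M N \<in> finite_borel_measures S"
    using assms(1) emeasure_add_measure[OF s] space_finite_borel_measures[OF assms(1)]
    by (auto simp: finite_borel_measures_def intro!: finite_measureI)
  show "measure (add_measure M N) S = measure M S + measure N S"
    using emeasure_add_measure[OF s] by (simp add: measure_def enn2real_plus M.emeasure_finite N.emeasure_finite less_top[symmetric])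
qed

lemma density_const_finite_borel:
  assumes "M \<in> finite_borel_measures S" "0 \<le> c"
  shows "density M (\<lambda>_. ennreal c) \<in> finite_borel_measures S"
    "measure (density M (\<lambda>_. ennreal c)) S = c * measure M S"
proof -
  interpret M: finite_measure M using assms by (simp add: finite_borel_measures_def)
  have s: "S \<in> sets M"
    using space_finite_borel_measures[OF assms(1)] sets.top[of M] by simp
  have e: "emeasure (density M (\<lambda>_. ennreal c)) S = ennreal c * emeasure M S"
    using s by (simp add: emeasure_density_const)
  show "density M (\<lambda>_. ennreal c) \<in> finite_borel_measures S"
    using assms e space_finite_borel_measures[OF assms(1)]
    by (auto simp: finite_borel_measures_def ennreal_mult_eq_top_iff intro!: finite_measureI)
  show "measure (density M (\<lambda>_. ennreal c)) S = c * measure M S"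
    using e assms(2) by (simp add: measure_def enn2real_mult)
qed

lemma null_measure_finite_borel:
  "null_measure (borel_on S) \<in> finite_borel_measures S"
  by (auto simp: finite_borel_measures_def intro!: finite_measureI)

lemma integrable_finite_borel:
  fixes f :: "'a::topological_space \<Rightarrow> real"
  assumes "M \<in> finite_borel_measures S" "f \<in> borel_measurable (borel_on S)" "\<And>w. w \<in> S \<Longrightarrow> \<bar>f w\<bar> \<le> K"
  shows "integrable M f"
proof -
  interpret M: finite_measure M using assms by (simp add: finite_borel_measures_def)
  have "f \<in> borel_measurable M"
    using assms by (simp add: finite_borel_measures_def cong: measurable_cong_sets)
  then show ?thesis
    using assms(3) space_finite_borel_measures[OF assms(1)]
    by (intro M.integrable_const_bound[of f K]) (auto intro!: AE_I2)
qed

text \<open>Point evaluation is controlled by total mass in this way, which later yields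
  definiteness of the norm and the vanishing of a function of cost zero.\<close>

lemma abs_integral_finite_borel_le:
  fixes f :: "'a::topological_space \<Rightarrow> real"
  assumes "M \<in> finite_borel_measures S" "f \<in> borel_measurable (borel_on S)" "\<And>w. w \<in> S \<Longrightarrow> \<bar>f w\<bar> \<le> K"
  shows "\<bar>\<integral>w. f w \<partial>M\<bar> \<le> K * measure M S"
proof -
  interpret M: finite_measure M using assms by (simp add: finite_borel_measures_def)
  have "\<bar>\<integral>w. f w \<partial>M\<bar> \<le> (\<integral>w. \<bar>f w\<bar> \<partial>M)"
    by simp
  also have "\<dots> \<le> (\<integral>w. K \<partial>M)"
    using integrable_finite_borel[OF assms] assms(3) space_finite_borel_measures[OF assms(1)]
    by (intro integral_mono) auto
  finally show ?thesis
    using space_finite_borel_measures[OF assms(1)] by (simp add: mult.commute)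
qed

subsection \<open>Total variation and Jordan decomposition\<close>

lemma Borel_subset: "A \<in> sets (borel_on \<Omega>) \<Longrightarrow> A \<subseteq> \<Omega>"
  using sets.sets_into_space[of A "borel_on \<Omega>"] by (simp add: space_restrict_space)

lemma top_in_borel_on [simp]: "\<Omega> \<in> sets (borel_on \<Omega>)"
  using sets.top[of "borel_on \<Omega>"] by (simp add: space_restrict_space)

lemma disjoint_family_on_partition: "partition_on A P \<Longrightarrow> disjoint_family_on (\<lambda>x. x) P"
  by (auto simp del: disjoint_iff simp: partition_on_def disjoint_family_on_def dest: disjointD)

lemma total_variation_leI:
  assumes "\<And>P. finite P \<Longrightarrow> P \<subseteq> sets (borel_on \<Omega>) \<Longrightarrow> partition_on A P \<Longrightarrow> (\<Sum>B\<in>P. ennreal \<bar>\<mu> B\<bar>) \<le> c"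
  shows "total_variation \<Omega> \<mu> A \<le> c"
  unfolding total_variation_def using assms by (intro SUP_least) auto

text \<open>\<open>total_variation\<close> admits only exact partitions into nonempty blocks.
  Dropping empty members and adding the remainder of \<open>A\<close> as one more block extends the
  bound to indexed disjoint families that may leave part of \<open>A\<close> uncovered.\<close>

lemma sum_le_total_variation:
  fixes \<mu> :: "'a::topological_space set \<Rightarrow> real"
  assumes empty: "\<mu> {} = 0" and A: "A \<in> sets (borel_on \<Omega>)"
    and I: "finite I" "\<And>i. i \<in> I \<Longrightarrow> B i \<in> sets (borel_on \<Omega>)" "\<And>i. i \<in> I \<Longrightarrow> B i \<subseteq> A"
      "disjoint_family_on B I"
  shows "(\<Sum>i\<in>I. ennreal \<bar>\<mu> (B i)\<bar>) \<le> total_variation \<Omega> \<mu> A"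
proof -
  \<comment> \<open>Empty members are dropped since \<open>partition_on\<close> forbids them and
    \<open>B\<close> could repeat the empty set; on \<open>J\<close> disjointness makes
    \<open>B\<close> injective.\<close>
  define J where "J = {i \<in> I. B i \<noteq> {}}"
  define R where "R = A - (\<Union>i\<in>I. B i)"
  define P where "P = B ` J \<union> ({R} - {{}})"
  have inj: "inj_on B J"
  proof (rule inj_onI, rule ccontr)
    fix i j assume ij: "i \<in> J" "j \<in> J" "B i = B j" "i \<noteq> j"
    then have "B i \<inter> B j = {}"
      using I(4) by (auto simp: J_def disjoint_family_on_def)
    then show False using ij by (simp add: J_def)
  qed
  have "partition_on A P"
  proof (rule partition_onI)
    show "\<Union>P = A"
      using I(3) by (fastforce simp: P_def R_def J_def)
    fix p q assume "p \<in> P" "q \<in> P" "p \<noteq> q"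
    moreover have "disjnt (B i) (B j)" if "i \<in> J" "j \<in> J" "B i \<noteq> B j" for i j
    proof -
      have "i \<in> I" "j \<in> I" "i \<noteq> j" using that by (auto simp: J_def)
      then show ?thesis using I(4) by (simp add: disjoint_family_on_def disjnt_def)
    qed
    moreover have "disjnt (B i) R" "disjnt R (B i)" if "i \<in> J" for i
      using that by (auto simp: R_def J_def disjnt_def)
    ultimately show "disjnt p q"
      unfolding P_def by blast
  qed (auto simp: P_def J_def)
  moreover have "finite P"
    using I(1) by (simp add: P_def J_def)
  moreover have "P \<subseteq> sets (borel_on \<Omega>)"
    using I(1,2) sets.Diff[OF A sets.finite_UN[of I B]] by (auto simp: P_def R_def J_def)
  ultimately have P: "(\<Sum>B\<in>P. ennreal \<bar>\<mu> B\<bar>) \<le> total_variation \<Omega> \<mu> A"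
    unfolding total_variation_def by (intro SUP_upper) simp
  have "(\<Sum>i\<in>I. ennreal \<bar>\<mu> (B i)\<bar>) = (\<Sum>i\<in>J. ennreal \<bar>\<mu> (B i)\<bar>)"
    using I(1) empty by (intro sum.mono_neutral_right) (auto simp: J_def)
  also have "\<dots> = (\<Sum>C\<in>B ` J. ennreal \<bar>\<mu> C\<bar>)"
    using inj by (simp add: sum.reindex)
  also have "\<dots> \<le> (\<Sum>B\<in>P. ennreal \<bar>\<mu> B\<bar>)"
    using I(1) by (intro sum_mono2) (auto simp: P_def J_def)
  also note P
  finally show ?thesis .
qed

text \<open>If the series does not converge absolutely, the right-hand side is infinite; otherwise
  this is the triangle inequality for series.\<close>

lemma ennreal_abs_le_suminf:
  fixes x :: "nat \<Rightarrow> real"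
  assumes "x sums s"
  shows "ennreal \<bar>s\<bar> \<le> (\<Sum>i. ennreal \<bar>x i\<bar>)"
proof (cases "(\<Sum>i. ennreal \<bar>x i\<bar>) = \<top>")
  case False
  then have s: "summable (\<lambda>i. \<bar>x i\<bar>)"
    by (intro summable_suminf_not_top) auto
  have "\<bar>s\<bar> \<le> (\<Sum>i. \<bar>x i\<bar>)"
    using summable_rabs[OF s] assms by (simp add: sums_unique[symmetric])
  then show ?thesis
    using s by (simp add: suminf_ennreal2 ennreal_leI)
qed simp

text \<open>These are the conditions of \<open>signed_radon_measures\<close> other than regularity,
  which is recovered later for closed subsets of Polish spaces.\<close>

locale finite_signed_measure =
  fixes \<Omega> :: "'a::topological_space set" and \<mu> :: "'a set \<Rightarrow> real"
  assumes empty: "\<mu> {} = 0"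
    and sums: "\<And>A::nat \<Rightarrow> 'a set. range A \<subseteq> sets (borel_on \<Omega>) \<Longrightarrow> disjoint_family A \<Longrightarrow>
      (\<lambda>i. \<mu> (A i)) sums \<mu> (\<Union>i. A i)"
    and finite_total_variation: "total_variation \<Omega> \<mu> \<Omega> < \<infinity>"
begin

lemma total_variation_mono:
  assumes "A \<subseteq> B" "A \<in> sets (borel_on \<Omega>)" "B \<in> sets (borel_on \<Omega>)"
  shows "total_variation \<Omega> \<mu> A \<le> total_variation \<Omega> \<mu> B"
proof (rule total_variation_leI)
  fix P assume "finite P" "P \<subseteq> sets (borel_on \<Omega>)" "partition_on A P"
  then show "(\<Sum>B\<in>P. ennreal \<bar>\<mu> B\<bar>) \<le> total_variation \<Omega> \<mu> B"
    using assms by (intro sum_le_total_variation[where \<mu> = \<mu>, OF empty])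
      (auto simp: partition_on_def disjoint_family_on_def disjoint_def)
qed

text \<open>A partition of \<open>A\<close> and one of \<open>B\<close> together partition the
  union, so their sums add up to at most its variation; suprema are then taken over both in
  turn.\<close>

lemma total_variation_superadditive:
  assumes "A \<inter> B = {}" and AB: "A \<in> sets (borel_on \<Omega>)" "B \<in> sets (borel_on \<Omega>)"
  shows "total_variation \<Omega> \<mu> A + total_variation \<Omega> \<mu> B \<le> total_variation \<Omega> \<mu> (A \<union> B)"
proof -
  let ?\<P> = "\<lambda>A. {P. finite P \<and> P \<subseteq> sets (borel_on \<Omega>) \<and> partition_on A P}"
  let ?s = "\<lambda>P. \<Sum>B\<in>P. ennreal \<bar>\<mu> B\<bar>"
  \<comment> \<open>Moving a constant into a supremum in \<open>ennreal\<close> requires a nonempty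
    index set; \<open>{C} - {{}}\<close> also serves when \<open>C\<close> is empty.\<close>
  have ne: "?\<P> C \<noteq> {}" if "C \<in> sets (borel_on \<Omega>)" for C
    using that by (auto intro!: exI[of _ "{C} - {{}}"] simp: partition_on_def disjoint_def)
  have *: "?s P + ?s Q \<le> total_variation \<Omega> \<mu> (A \<union> B)" if P: "P \<in> ?\<P> A" and Q: "Q \<in> ?\<P> B" for P Q
  proof -
    have PQ: "\<Union>P = A" "\<Union>Q = B" "{} \<notin> P" "{} \<notin> Q"
      using P Q by (auto simp: partition_on_def)
    have disj: "P \<inter> Q = {}"
    proof (rule ccontr)
      assume "P \<inter> Q \<noteq> {}"
      then obtain C where "C \<in> P" "C \<in> Q" by blast
      with PQ have "C \<subseteq> A \<inter> B" "C \<noteq> {}" by auto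
      with assms(1) show False by simp
    qed
    then have "?s P + ?s Q = ?s (P \<union> Q)"
      using P Q by (intro sum.union_disjoint[symmetric]) auto
    also have "\<dots> \<le> total_variation \<Omega> \<mu> (A \<union> B)"
    proof (intro sum_le_total_variation[where \<mu> = \<mu>, OF empty])
      have "C \<inter> D = {}" if "C \<in> P" "D \<in> Q" for C D
        using that PQ assms(1) by blast
      then show "disjoint_family_on (\<lambda>x. x) (P \<union> Q)"
        using disjoint_family_on_partition[of A P] disjoint_family_on_partition[of B Q] P Q
        unfolding disjoint_family_on_def by (metis (no_types, lifting) Int_commute Un_iff mem_Collect_eq)
    qed (use P Q AB PQ in auto)
    finally show ?thesis .
  qed
  have "?s P + total_variation \<Omega> \<mu> B \<le> total_variation \<Omega> \<mu> (A \<union> B)" if P: "P \<in> ?\<P> A" for P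
    unfolding total_variation_def[of \<Omega> \<mu> B]
    unfolding ennreal_SUP_add_right[OF ne[OF AB(2)]]
    using *[OF P] by (intro SUP_least)
  then show ?thesis
    unfolding total_variation_def[of \<Omega> \<mu> A]
    unfolding ennreal_SUP_add_left[OF ne[OF AB(1)], symmetric]
    by (intro SUP_least)
qed

text \<open>The bound from below for the union comes from superadditivity over finite unions and
  monotonicity. For the other bound each block of a partition is cut along the \<open>A i\<close>:
  countable additivity of \<open>\<mu>\<close> bounds it by its pieces, and the pieces inside one
  \<open>A i\<close> form a disjoint family there.\<close>

lemma total_variation_countably_additive:
  fixes A :: "nat \<Rightarrow> 'a set"
  assumes A: "range A \<subseteq> sets (borel_on \<Omega>)" "disjoint_family A"
  shows "(\<Sum>i. total_variation \<Omega> \<mu> (A i)) = total_variation \<Omega> \<mu> (\<Union>i. A i)"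
proof (rule antisym)
  have m: "A i \<in> sets (borel_on \<Omega>)" for i using A by auto
  have "(\<Sum>i<n. total_variation \<Omega> \<mu> (A i)) \<le> total_variation \<Omega> \<mu> (\<Union>i<n. A i)" for n
  proof (induction n)
    case (Suc n)
    have "(\<Sum>i<Suc n. total_variation \<Omega> \<mu> (A i)) \<le> total_variation \<Omega> \<mu> (\<Union>i<n. A i) + total_variation \<Omega> \<mu> (A n)"
      using Suc by (simp add: add_mono)
    also have "\<dots> \<le> total_variation \<Omega> \<mu> ((\<Union>i<n. A i) \<union> A n)"
    proof (rule total_variation_superadditive)
      have "A i \<inter> A n = {}" if "i < n" for i
        using A(2) that by (simp add: disjoint_family_on_def)
      then show "(\<Union>i<n. A i) \<inter> A n = {}" by blast
    qed (use m in auto)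
    finally show ?case by (simp add: lessThan_Suc Un_commute)
  qed simp
  also have "\<dots> n \<le> total_variation \<Omega> \<mu> (\<Union>i. A i)" for n
    using m by (intro total_variation_mono) auto
  finally show "(\<Sum>i. total_variation \<Omega> \<mu> (A i)) \<le> total_variation \<Omega> \<mu> (\<Union>i. A i)"
    by (simp add: suminf_eq_SUP SUP_least)
next
  have m: "A i \<in> sets (borel_on \<Omega>)" for i using A by auto
  show "total_variation \<Omega> \<mu> (\<Union>i. A i) \<le> (\<Sum>i. total_variation \<Omega> \<mu> (A i))"
  proof (rule total_variation_leI)
    fix P assume P: "finite P" "P \<subseteq> sets (borel_on \<Omega>)" "partition_on (\<Union>i. A i) P"
    have "(\<Sum>B\<in>P. ennreal \<bar>\<mu> B\<bar>) \<le> (\<Sum>B\<in>P. \<Sum>i. ennreal \<bar>\<mu> (B \<inter> A i)\<bar>)"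
    proof (intro sum_mono ennreal_abs_le_suminf)
      fix B assume B: "B \<in> P"
      then have "(\<Union>i. B \<inter> A i) = B"
        using P(3) by (auto simp: partition_on_def)
      moreover have "(\<lambda>i. \<mu> (B \<inter> A i)) sums \<mu> (\<Union>i. B \<inter> A i)"
        using m P(2) B disjoint_family_subset[OF A(2), of "\<lambda>i. B \<inter> A i"] by (intro sums) auto
      ultimately show "(\<lambda>i. \<mu> (B \<inter> A i)) sums \<mu> B" by simp
    qed
    also have "\<dots> = (\<Sum>i. \<Sum>B\<in>P. ennreal \<bar>\<mu> (B \<inter> A i)\<bar>)"
      by (intro suminf_sum[symmetric] summableI)
    also have "\<dots> \<le> (\<Sum>i. total_variation \<Omega> \<mu> (A i))"
    proof (intro suminf_le sum_le_total_variation[where \<mu> = \<mu>, OF empty] summableI)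
      \<comment> \<open>Several pieces \<open>B \<inter> A i\<close> may be empty and so coincide;
        they are kept as a family indexed by the blocks.\<close>
      show "disjoint_family_on (\<lambda>B. B \<inter> A i) P" for i
        by (rule disjoint_family_on_bisimulation[OF disjoint_family_on_partition[OF P(3)]]) auto
    qed (use P m in auto)
    finally show "(\<Sum>B\<in>P. ennreal \<bar>\<mu> B\<bar>) \<le> (\<Sum>i. total_variation \<Omega> \<mu> (A i))" .
  qed
qed

lemma total_variation_lt_top: "A \<in> sets (borel_on \<Omega>) \<Longrightarrow> total_variation \<Omega> \<mu> A < \<top>"
  using total_variation_mono[of A \<Omega>] finite_total_variation Borel_subset[of A \<Omega>]
  by (auto intro: le_less_trans)

text \<open>The family with the single member \<open>A\<close> gives this. It is what makes both
  Jordan parts nonnegative.\<close>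

lemma abs_le_total_variation:
  assumes A: "A \<in> sets (borel_on \<Omega>)"
  shows "\<bar>\<mu> A\<bar> \<le> enn2real (total_variation \<Omega> \<mu> A)"
proof -
  have "ennreal \<bar>\<mu> A\<bar> \<le> total_variation \<Omega> \<mu> A"
    using sum_le_total_variation[where \<mu> = \<mu>, OF empty A, of "{()}" "\<lambda>_. A"] A
    by (simp add: disjoint_family_on_def)
  from enn2real_mono[OF this total_variation_lt_top[OF A]] show ?thesis by simp
qed

text \<open>Countable additivity is moved from \<open>ennreal\<close> to the reals, where it can be
  combined with the signed series for \<open>\<mu>\<close>.\<close>

lemma total_variation_sums:
  fixes A :: "nat \<Rightarrow> 'a set"
  assumes A: "range A \<subseteq> sets (borel_on \<Omega>)" "disjoint_family A"
  shows "(\<lambda>i. enn2real (total_variation \<Omega> \<mu> (A i))) sums enn2real (total_variation \<Omega> \<mu> (\<Union>i. A i))"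
proof -
  have m: "A i \<in> sets (borel_on \<Omega>)" for i using A by auto
  have e: "ennreal (enn2real (total_variation \<Omega> \<mu> (A i))) = total_variation \<Omega> \<mu> (A i)" for i
    using total_variation_lt_top[OF m] by simp
  have t: "(\<Sum>i. total_variation \<Omega> \<mu> (A i)) < \<top>"
    unfolding total_variation_countably_additive[OF A] using m by (intro total_variation_lt_top) auto
  have s: "summable (\<lambda>i. enn2real (total_variation \<Omega> \<mu> (A i)))"
    by (rule summable_suminf_not_top) (use t in \<open>auto simp: e\<close>)
  have "total_variation \<Omega> \<mu> (\<Union>i. A i) = ennreal (\<Sum>i. enn2real (total_variation \<Omega> \<mu> (A i)))"
    using suminf_ennreal2[OF _ s] total_variation_countably_additive[OF A] by (simp only: e enn2real_nonneg)
  then have "enn2real (total_variation \<Omega> \<mu> (\<Union>i. A i)) = (\<Sum>i. enn2real (total_variation \<Omega> \<mu> (A i)))"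
    using suminf_nonneg[OF s] by (simp only: enn2real_nonneg enn2real_ennreal)
  then show ?thesis
    using summable_sums[OF s] by simp
qed

section \<open>The Jordan parts as measures\<close>

lemma
  shows sets_positive_part: "sets (positive_part \<Omega> \<mu>) = sets (borel_on \<Omega>)"
    and sets_negative_part: "sets (negative_part \<Omega> \<mu>) = sets (borel_on \<Omega>)"
  using sets.sets_measure_of_eq[of "borel_on \<Omega>"]
  by (simp_all add: positive_part_def negative_part_def space_restrict_space)

text \<open>One argument serves both Jordan parts, with \<open>c = 1\<close> and
  \<open>c = -1\<close>. The set function is nonnegative because the variation dominates
  \<open>\<bar>\<mu> B\<bar>\<close>, and its additivity follows from two convergent real
  series.\<close>

lemma half_part_emeasure:
  assumes c: "\<bar>c\<bar> = 1" and A: "A \<in> sets (borel_on \<Omega>)"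
  shows "emeasure (measure_of \<Omega> (sets (borel_on \<Omega>))
      (\<lambda>A. ennreal ((enn2real (total_variation \<Omega> \<mu> A) + c * \<mu> A) / 2))) A =
    ennreal ((enn2real (total_variation \<Omega> \<mu> A) + c * \<mu> A) / 2)"
proof (rule emeasure_measure_of_sigma)
  show "sigma_algebra \<Omega> (sets (borel_on \<Omega>))"
    using sets.sigma_algebra_axioms[of "borel_on \<Omega>"] by (simp add: space_restrict_space)
  show "positive (sets (borel_on \<Omega>)) (\<lambda>A. ennreal ((enn2real (total_variation \<Omega> \<mu> A) + c * \<mu> A) / 2))"
    using empty by (auto simp: positive_def total_variation_def partition_on_empty)
  show "countably_additive (sets (borel_on \<Omega>)) (\<lambda>A. ennreal ((enn2real (total_variation \<Omega> \<mu> A) + c * \<mu> A) / 2))"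
    unfolding countably_additive_def
  proof (intro allI impI suminf_ennreal_eq)
    fix B :: "nat \<Rightarrow> 'a set" and i
    assume B: "range B \<subseteq> sets (borel_on \<Omega>)" "disjoint_family B"
    have "\<bar>c * \<mu> (B i)\<bar> \<le> enn2real (total_variation \<Omega> \<mu> (B i))"
      using abs_le_total_variation[of "B i"] B(1) c by (auto simp: abs_mult)
    then show "0 \<le> (enn2real (total_variation \<Omega> \<mu> (B i)) + c * \<mu> (B i)) / 2"
      by simp
    show "(\<lambda>i. (enn2real (total_variation \<Omega> \<mu> (B i)) + c * \<mu> (B i)) / 2) sums
        ((enn2real (total_variation \<Omega> \<mu> (\<Union>i. B i)) + c * \<mu> (\<Union>i. B i)) / 2)"
      by (intro sums_divide sums_add sums_mult total_variation_sums sums B)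
  qed
qed fact

lemma
  assumes "A \<in> sets (borel_on \<Omega>)"
  shows emeasure_positive_part: "emeasure (positive_part \<Omega> \<mu>) A = ennreal ((enn2real (total_variation \<Omega> \<mu> A) + \<mu> A) / 2)"
    and emeasure_negative_part: "emeasure (negative_part \<Omega> \<mu>) A = ennreal ((enn2real (total_variation \<Omega> \<mu> A) - \<mu> A) / 2)"
    and measure_positive_part: "measure (positive_part \<Omega> \<mu>) A = (enn2real (total_variation \<Omega> \<mu> A) + \<mu> A) / 2"
    and measure_negative_part: "measure (negative_part \<Omega> \<mu>) A = (enn2real (total_variation \<Omega> \<mu> A) - \<mu> A) / 2"
proof -
  show p: "emeasure (positive_part \<Omega> \<mu>) A = ennreal ((enn2real (total_variation \<Omega> \<mu> A) + \<mu> A) / 2)"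
    and n: "emeasure (negative_part \<Omega> \<mu>) A = ennreal ((enn2real (total_variation \<Omega> \<mu> A) - \<mu> A) / 2)"
    using half_part_emeasure[of 1 A] half_part_emeasure[of "-1" A] assms
    by (simp_all add: positive_part_def negative_part_def)
  show "measure (positive_part \<Omega> \<mu>) A = (enn2real (total_variation \<Omega> \<mu> A) + \<mu> A) / 2"
    and "measure (negative_part \<Omega> \<mu>) A = (enn2real (total_variation \<Omega> \<mu> A) - \<mu> A) / 2"
    using abs_le_total_variation[OF assms] by (simp_all add: measure_def p n)
qed

lemma
  shows positive_part_finite_borel: "positive_part \<Omega> \<mu> \<in> finite_borel_measures \<Omega>"
    and negative_part_finite_borel: "negative_part \<Omega> \<mu> \<in> finite_borel_measures \<Omega>"
proof -
  have "space (positive_part \<Omega> \<mu>) = \<Omega>" "space (negative_part \<Omega> \<mu>) = \<Omega>"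
    using sets_eq_imp_space_eq[OF sets_positive_part] sets_eq_imp_space_eq[OF sets_negative_part]
    by (simp_all add: space_restrict_space)
  then show "positive_part \<Omega> \<mu> \<in> finite_borel_measures \<Omega>" "negative_part \<Omega> \<mu> \<in> finite_borel_measures \<Omega>"
    by (auto simp: finite_borel_measures_def sets_positive_part sets_negative_part
        emeasure_positive_part emeasure_negative_part intro!: finite_measureI)
qed

lemma variation_norm_eq:
  "variation_norm \<Omega> \<mu> = measure (positive_part \<Omega> \<mu>) \<Omega> + measure (negative_part \<Omega> \<mu>) \<Omega>"
  by (simp add: variation_norm_def measure_positive_part measure_negative_part field_simps)

end

lemma signed_radon_imp_finite_signed_measure:
  "\<mu> \<in> signed_radon_measures \<Omega> \<Longrightarrow> finite_signed_measure \<Omega> \<mu>"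
  by (unfold_locales) (auto simp: signed_radon_measures_def)

section \<open>Differences of two finite measures\<close>

context
  fixes \<Omega> :: "'a::topological_space set" and P N :: "'a measure" and \<mu>
  assumes PN: "P \<in> finite_borel_measures \<Omega>" "N \<in> finite_borel_measures \<Omega>"
    and \<mu>: "\<And>A. A \<in> sets (borel_on \<Omega>) \<Longrightarrow> \<mu> A = measure P A - measure N A"
begin

text \<open>Each block satisfies \<open>\<bar>\<mu> B\<bar> \<le> measure P B + measure N B\<close>,
  and both measures add up over the blocks. Equality can fail, as \<open>P\<close> and
  \<open>N\<close> may overlap.\<close>

lemma total_variation_diff_le:
  assumes A: "A \<in> sets (borel_on \<Omega>)"
  shows "total_variation \<Omega> \<mu> A \<le> ennreal (measure P A + measure N A)"
proof (rule total_variation_leI)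
  interpret P: finite_measure P using PN by (simp add: finite_borel_measures_def)
  interpret N: finite_measure N using PN by (simp add: finite_borel_measures_def)
  have s: "sets P = sets (borel_on \<Omega>)" "sets N = sets (borel_on \<Omega>)"
    using PN by (auto simp: finite_borel_measures_def)
  fix Q assume Q: "finite Q" "Q \<subseteq> sets (borel_on \<Omega>)" "partition_on A Q"
  have "(\<Sum>B\<in>Q. \<bar>\<mu> B\<bar>) \<le> (\<Sum>B\<in>Q. measure P B + measure N B)"
    using Q(2) by (intro sum_mono) (auto simp: \<mu> abs_le_iff intro: add_increasing add_increasing2)
  also have "\<dots> = measure P A + measure N A"
    using Q s P.finite_measure_finite_Union[of Q "\<lambda>x. x"] N.finite_measure_finite_Union[of Q "\<lambda>x. x"]
    by (auto simp: sum.distrib partition_on_def disjoint_family_on_def disjoint_def)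
  finally show "(\<Sum>B\<in>Q. ennreal \<bar>\<mu> B\<bar>) \<le> ennreal (measure P A + measure N A)"
    by (simp add: ennreal_leI del: ennreal_plus)
qed

lemma finite_signed_measure_diff: "finite_signed_measure \<Omega> \<mu>"
proof
  interpret P: finite_measure P using PN by (simp add: finite_borel_measures_def)
  interpret N: finite_measure N using PN by (simp add: finite_borel_measures_def)
  have s: "sets P = sets (borel_on \<Omega>)" "sets N = sets (borel_on \<Omega>)"
    using PN by (auto simp: finite_borel_measures_def)
  show "\<mu> {} = 0" by (simp add: \<mu>)
  show "total_variation \<Omega> \<mu> \<Omega> < \<infinity>"
    using total_variation_diff_le[of \<Omega>] by (auto intro: le_less_trans)
  fix A :: "nat \<Rightarrow> 'a set"
  assume A: "range A \<subseteq> sets (borel_on \<Omega>)" "disjoint_family A"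
  then have "A i \<in> sets (borel_on \<Omega>)" for i by auto
  then show "(\<lambda>i. \<mu> (A i)) sums \<mu> (\<Union>i. A i)"
    using sums_diff[OF P.finite_measure_UNION N.finite_measure_UNION, of A A] A s
    by (auto simp: \<mu>)
qed

lemma variation_norm_diff_le: "variation_norm \<Omega> \<mu> \<le> measure P \<Omega> + measure N \<Omega>"
  unfolding variation_norm_def
  using enn2real_mono[OF total_variation_diff_le[of \<Omega>]] by (simp del: ennreal_plus)

lemma signed_integral_diff:
  assumes f: "f \<in> borel_measurable (borel_on \<Omega>)" "\<And>w. w \<in> \<Omega> \<Longrightarrow> \<bar>f w\<bar> \<le> K"
  shows "signed_integral \<Omega> \<mu> f = (\<integral>w. f w \<partial>P) - (\<integral>w. f w \<partial>N)"
proof -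
  interpret finite_signed_measure \<Omega> \<mu> by (rule finite_signed_measure_diff)
  interpret P: finite_measure P using PN by (simp add: finite_borel_measures_def)
  interpret N: finite_measure N using PN by (simp add: finite_borel_measures_def)
  have s: "sets P = sets (borel_on \<Omega>)" "sets N = sets (borel_on \<Omega>)"
    using PN by (auto simp: finite_borel_measures_def)
  \<comment> \<open>\<open>P\<close> and \<open>N\<close> need not be mutually singular; \<open>\<mu>\<^sup>+ + N = \<mu>\<^sup>- + P\<close> makes a Hahn decomposition unnecessary.\<close>
  have "add_measure (positive_part \<Omega> \<mu>) N = add_measure (negative_part \<Omega> \<mu>) P"
  proof (rule measure_eqI)
    fix A assume "A \<in> sets (add_measure (positive_part \<Omega> \<mu>) N)"
    then have A: "A \<in> sets (borel_on \<Omega>)" by (simp add: sets_positive_part)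
    have "ennreal ((enn2real (total_variation \<Omega> \<mu> A) + \<mu> A) / 2) + emeasure N A =
        ennreal ((enn2real (total_variation \<Omega> \<mu> A) + \<mu> A) / 2 + measure N A)"
      using abs_le_total_variation[OF A] by (subst ennreal_plus) (auto simp: N.emeasure_eq_measure)
    also have "\<dots> = ennreal ((enn2real (total_variation \<Omega> \<mu> A) - \<mu> A) / 2 + measure P A)"
      by (rule arg_cong[where f = ennreal]) (use \<mu>[OF A] in \<open>simp add: field_simps\<close>)
    also have "\<dots> = ennreal ((enn2real (total_variation \<Omega> \<mu> A) - \<mu> A) / 2) + emeasure P A"
      using abs_le_total_variation[OF A] by (subst ennreal_plus) (auto simp: P.emeasure_eq_measure)
    finally show "emeasure (add_measure (positive_part \<Omega> \<mu>) N) A = emeasure (add_measure (negative_part \<Omega> \<mu>) P) A"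
      using A s by (simp add: emeasure_add_measure sets_positive_part sets_negative_part
          emeasure_positive_part emeasure_negative_part)
  qed (simp add: sets_positive_part sets_negative_part)
  \<comment> \<open>The two sums give \<open>f\<close> the same integral; as \<open>f\<close> is
    bounded, all four integrals are finite and the terms can be rearranged.\<close>
  moreover note integral_add_measure[of N "positive_part \<Omega> \<mu>" f] integral_add_measure[of P "negative_part \<Omega> \<mu>" f]
  moreover note integrable_finite_borel[OF _ f]
  ultimately show ?thesis
    using s PN positive_part_finite_borel negative_part_finite_borel
    by (simp add: signed_integral_def sets_positive_part sets_negative_part)
qed

end

section \<open>Regularity on closed subsets of Polish spaces\<close>

text \<open>Extending \<open>M\<close> by zero to the whole space gives a finite Borel measure on a
  Polish space, which is regular. Closedness of \<open>\<Omega>\<close> makes its Borel subsets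
  Borel in the whole space, so both formulas can be restricted to \<open>\<Omega>\<close>.\<close>

lemma finite_borel_regular:
  fixes \<Omega> :: "'a::{second_countable_topology, complete_space} set"
  assumes M: "M \<in> finite_borel_measures \<Omega>" and \<Omega>: "closed \<Omega>" and A: "A \<in> sets (borel_on \<Omega>)"
  shows "emeasure M A = (SUP K\<in>{K. K \<subseteq> A \<and> compact K}. emeasure M K)"
    and "emeasure M A = (INF U\<in>{U. A \<subseteq> U \<and> openin (top_of_set \<Omega>) U}. emeasure M U)"
proof -
  interpret M: finite_measure M using M by (simp add: finite_borel_measures_def)
  have s: "sets M = sets (borel_on \<Omega>)" and sp: "space M = \<Omega>"
    using M space_finite_borel_measures by (auto simp: finite_borel_measures_def)
  define N where "N = distr M borel (\<lambda>x. x)"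
  have id: "(\<lambda>x. x) \<in> measurable M borel"
    using s by (simp add: measurable_cong_sets[OF s refl] measurable_restrict_space1)
  have eN: "emeasure N B = emeasure M (B \<inter> \<Omega>)" if "B \<in> sets borel" for B
    using that by (simp add: N_def emeasure_distr[OF id] sp)
  have A': "A \<in> sets borel" "A \<subseteq> \<Omega>"
    using A \<Omega> Borel_subset by (auto simp: sets_restrict_space_iff)
  have N: "sets N = sets borel" "emeasure N (space N) \<noteq> \<infinity>"
    using M.emeasure_finite by (simp_all add: N_def emeasure_distr[OF id])
  have "emeasure M A = emeasure N A"
    using A' by (simp add: eN Int_absorb2)
  also have "\<dots> = (SUP K\<in>{K. K \<subseteq> A \<and> compact K}. emeasure N K)"
    by (rule inner_regular) (use N A' in auto)
  also have "\<dots> = (SUP K\<in>{K. K \<subseteq> A \<and> compact K}. emeasure M K)"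
    using A' by (intro SUP_cong) (auto simp: eN borel_compact Int_absorb2)
  finally show "emeasure M A = (SUP K\<in>{K. K \<subseteq> A \<and> compact K}. emeasure M K)" .
  have "emeasure M A = emeasure N A"
    using A' by (simp add: eN Int_absorb2)
  also have "\<dots> = (INF U\<in>{U. A \<subseteq> U \<and> open U}. emeasure N U)"
    by (rule outer_regular) (use N A' in auto)
  also have "\<dots> = (INF U\<in>{U. A \<subseteq> U \<and> open U}. emeasure M (U \<inter> \<Omega>))"
    by (intro INF_cong) (auto simp: eN)
  \<comment> \<open>The traces on \<open>\<Omega>\<close> of open supersets of \<open>A\<close> are
    exactly its relatively open supersets.\<close>
  also have "\<dots> = (INF U\<in>(\<lambda>U. U \<inter> \<Omega>) ` {U. A \<subseteq> U \<and> open U}. emeasure M U)"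
    by (simp add: image_image)
  also have "(\<lambda>U. U \<inter> \<Omega>) ` {U. A \<subseteq> U \<and> open U} = {U. A \<subseteq> U \<and> openin (top_of_set \<Omega>) U}"
    using A'(2) by (auto simp: openin_open image_iff)
  finally show "emeasure M A = (INF U\<in>{U. A \<subseteq> U \<and> openin (top_of_set \<Omega>) U}. emeasure M U)" .
qed

text \<open>The variation coincides on Borel sets with the sum of the two Jordan parts, a finite
  Borel measure, and so inherits its regularity.\<close>

lemma finite_signed_measure_imp_signed_radon:
  fixes \<Omega> :: "'a::{second_countable_topology, complete_space} set"
  assumes "finite_signed_measure \<Omega> \<mu>" and \<Omega>: "closed \<Omega>"
  shows "\<mu> \<in> signed_radon_measures \<Omega>"
proof -
  interpret finite_signed_measure \<Omega> \<mu> by fact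
  define M where "M = add_measure (positive_part \<Omega> \<mu>) (negative_part \<Omega> \<mu>)"
  have M: "M \<in> finite_borel_measures \<Omega>"
    unfolding M_def by (intro add_measure_finite_borel positive_part_finite_borel negative_part_finite_borel)
  have tv: "total_variation \<Omega> \<mu> A = emeasure M A" if A: "A \<in> sets (borel_on \<Omega>)" for A
  proof -
    let ?t = "enn2real (total_variation \<Omega> \<mu> A)"
    have "emeasure M A = ennreal ((?t + \<mu> A) / 2) + ennreal ((?t - \<mu> A) / 2)"
      using A by (simp add: M_def emeasure_add_measure sets_positive_part sets_negative_part
          emeasure_positive_part emeasure_negative_part)
    also have "\<dots> = ennreal ((?t + \<mu> A) / 2 + (?t - \<mu> A) / 2)"
      using abs_le_total_variation[OF A] by (subst ennreal_plus) auto
    also have "(?t + \<mu> A) / 2 + (?t - \<mu> A) / 2 = ?t" by (simp add: field_simps)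
    finally show ?thesis using total_variation_lt_top[OF A] by simp
  qed
  \<comment> \<open>The competing sets in both regularity formulas are Borel, so \<open>tv\<close>
    may be applied inside the supremum and the infimum.\<close>
  have K: "K \<in> sets (borel_on \<Omega>)" if "K \<subseteq> A" "compact K" "A \<in> sets (borel_on \<Omega>)" for K A
    using that \<Omega> Borel_subset[of A] by (auto simp: sets_restrict_space_iff borel_compact)
  have U: "U \<in> sets (borel_on \<Omega>)" if "openin (top_of_set \<Omega>) U" for U
    using that \<Omega> by (auto simp: sets_restrict_space_iff openin_open)
  show ?thesis
    unfolding signed_radon_measures_def
    using empty sums finite_total_variation finite_borel_regular[OF M \<Omega>]
    by (auto simp: tv K U intro!: SUP_cong INF_cong)
qed

subsection \<open>Representations by pairs of finite measures\<close>

text \<open>\<open>S f\<close> stands for the costs of all representations of \<open>f\<close>.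
  Operations on representations bound the infimum from above, scaling by an inverse factor gives the
  reverse inequality for homogeneity, and \<open>bound\<close> yields definiteness.\<close>

lemma normed_function_space_Inf:
  fixes S :: "('x \<Rightarrow> real) \<Rightarrow> real set"
  assumes ext: "\<And>f. S f \<noteq> {} \<Longrightarrow> f \<in> extensional X"
    and zero: "0 \<in> S (\<lambda>x\<in>X. 0)"
    and add: "\<And>f g m n. m \<in> S f \<Longrightarrow> n \<in> S g \<Longrightarrow> m + n \<in> S (\<lambda>x\<in>X. f x + g x)"
    and scale: "\<And>c f m. m \<in> S f \<Longrightarrow> \<bar>c\<bar> * m \<in> S (\<lambda>x\<in>X. c * f x)"
    and nonneg: "\<And>f m. m \<in> S f \<Longrightarrow> 0 \<le> m"
    and bound: "\<And>f m x. m \<in> S f \<Longrightarrow> x \<in> X \<Longrightarrow> \<bar>f x\<bar> \<le> K x * m"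
  shows "normed_function_space X {f. S f \<noteq> {}} (\<lambda>f. Inf (S f))"
proof -
  have bdd: "bdd_below (S f)" for f
    using nonneg by (intro bdd_belowI) auto
  have Inf_nonneg: "0 \<le> Inf (S f)" if "S f \<noteq> {}" for f
    using that nonneg by (intro cInf_greatest) auto
  have Inf_zero: "Inf (S (\<lambda>x\<in>X. 0)) = 0"
    using cInf_lower[OF zero bdd] Inf_nonneg[of "\<lambda>x\<in>X. 0"] zero by (intro antisym) auto
  have Inf_add: "Inf (S (\<lambda>x\<in>X. f x + g x)) \<le> Inf (S f) + Inf (S g)" if "S f \<noteq> {}" "S g \<noteq> {}" for f g
  proof -
    \<comment> \<open>The infimum over \<open>S f\<close> is taken with \<open>n\<close> fixed, and
      then the one over \<open>S g\<close>.\<close>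
    have "Inf (S (\<lambda>x\<in>X. f x + g x)) - n \<le> Inf (S f)" if "n \<in> S g" for n
      using that \<open>S f \<noteq> {}\<close> cInf_lower[OF add bdd] by (intro cInf_greatest) (auto simp: diff_le_eq)
    then have "Inf (S (\<lambda>x\<in>X. f x + g x)) - Inf (S f) \<le> Inf (S g)"
      using \<open>S g \<noteq> {}\<close> by (intro cInf_greatest) (auto simp: diff_le_eq le_diff_eq algebra_simps)
    then show ?thesis by simp
  qed
  have Inf_scale_le: "Inf (S (\<lambda>x\<in>X. c * f x)) \<le> \<bar>c\<bar> * Inf (S f)" if "S f \<noteq> {}" "c \<noteq> 0" for c f
  proof -
    have "Inf (S (\<lambda>x\<in>X. c * f x)) / \<bar>c\<bar> \<le> Inf (S f)"
      using that cInf_lower[OF scale[of _ f c] bdd] by (intro cInf_greatest) (auto simp: field_simps)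
    then show ?thesis using that by (simp add: field_simps)
  qed
  have Inf_scale: "Inf (S (\<lambda>x\<in>X. c * f x)) = \<bar>c\<bar> * Inf (S f)" if f: "S f \<noteq> {}" for c f
  proof (cases "c = 0")
    case True
    then show ?thesis using Inf_zero by simp
  next
    case False
    have ne: "S (\<lambda>x\<in>X. c * f x) \<noteq> {}" using f scale by blast
    \<comment> \<open>Scaling back by \<open>inverse c\<close> returns \<open>f\<close> itself,
      because \<open>f\<close> is extensional; this gives the reverse inequality.\<close>
    have "(\<lambda>x\<in>X. inverse c * (\<lambda>x\<in>X. c * f x) x) = f"
      using False ext[OF f] by (auto simp: extensional_def restrict_def fun_eq_iff)
    then have "Inf (S f) \<le> \<bar>inverse c\<bar> * Inf (S (\<lambda>x\<in>X. c * f x))"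
      using Inf_scale_le[OF ne, of "inverse c"] False by simp
    then show ?thesis
      using Inf_scale_le[OF f False] False by (intro antisym) (auto simp: field_simps)
  qed
  have Inf_zeroD: "f = (\<lambda>x\<in>X. 0)" if f: "S f \<noteq> {}" and "Inf (S f) = 0" for f
  proof -
    have "f x = 0" if x: "x \<in> X" for x
    \<comment> \<open>For \<open>K x \<le> 0\<close> a single cost already forces
      \<open>f x = 0\<close>; otherwise \<open>\<bar>f x\<bar> / K x\<close> is a lower bound for
      the costs.\<close>
    proof (cases "K x \<le> 0")
      case True
      obtain m where "m \<in> S f" using f by blast
      then show ?thesis
        using bound[of m f x] nonneg[of m f] x True mult_nonpos_nonneg[of "K x" m] by simp
    next
      case False
      then have "\<bar>f x\<bar> / K x \<le> Inf (S f)"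
        using f bound[OF _ x] by (intro cInf_greatest) (auto simp: field_simps)
      then show ?thesis using False \<open>Inf (S f) = 0\<close> by (simp add: field_simps)
    qed
    then show ?thesis
      using ext[OF f] by (auto simp: extensional_def restrict_def fun_eq_iff)
  qed
  show ?thesis
    unfolding normed_function_space_def
    using ext zero add scale Inf_zero Inf_add Inf_scale Inf_zeroD by auto (metis all_not_in_conv)+
qed

text \<open>The common description of both spaces, whose norms are infima of these costs.
  \<open>P\<close> and \<open>N\<close> may overlap, so representations can be added part by
  part.\<close>

definition representation_costs ::
    "'x set \<Rightarrow> 'w::topological_space set \<Rightarrow> ('x \<Rightarrow> 'w \<Rightarrow> real) \<Rightarrow> ('x \<Rightarrow> real) \<Rightarrow> real set" where
  "representation_costs X \<Omega> \<phi> f =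
     {measure P \<Omega> + measure N \<Omega> |P N. P \<in> finite_borel_measures \<Omega> \<and> N \<in> finite_borel_measures \<Omega> \<and>
        f = (\<lambda>x\<in>X. (\<integral>w. \<phi> x w \<partial>P) - (\<integral>w. \<phi> x w \<partial>N))}"

text \<open>The bound may vary with \<open>x\<close>: it makes each \<open>\<phi> x\<close>
  integrable against every finite measure and bounds the value at \<open>x\<close> by a multiple of
  the cost.\<close>

locale bounded_kernel =
  fixes X :: "'x set" and \<Omega> :: "'w::{second_countable_topology, complete_space} set"
    and \<phi> :: "'x \<Rightarrow> 'w \<Rightarrow> real" and K :: "'x \<Rightarrow> real"
  assumes closed: "closed \<Omega>"
    and kernel_measurable: "\<And>x. x \<in> X \<Longrightarrow> \<phi> x \<in> borel_measurable (borel_on \<Omega>)"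
    and kernel_bound: "\<And>x w. x \<in> X \<Longrightarrow> w \<in> \<Omega> \<Longrightarrow> \<bar>\<phi> x w\<bar> \<le> K x"
begin

lemma kernel_integrable: "M \<in> finite_borel_measures \<Omega> \<Longrightarrow> x \<in> X \<Longrightarrow> integrable M (\<phi> x)"
  using integrable_finite_borel[OF _ kernel_measurable kernel_bound] by blast

lemma normed_function_space_representation_costs:
  "normed_function_space X {f. representation_costs X \<Omega> \<phi> f \<noteq> {}} (\<lambda>f. Inf (representation_costs X \<Omega> \<phi> f))"
proof (rule normed_function_space_Inf)
  show "0 \<in> representation_costs X \<Omega> \<phi> (\<lambda>x\<in>X. 0)"
    using null_measure_finite_borel[of \<Omega>]
    by (auto simp: representation_costs_def intro!: exI[of _ "null_measure (borel_on \<Omega>)"] restrict_ext)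
next
  fix f g m n assume "m \<in> representation_costs X \<Omega> \<phi> f" "n \<in> representation_costs X \<Omega> \<phi> g"
  then obtain P N P' N' where PN: "P \<in> finite_borel_measures \<Omega>" "N \<in> finite_borel_measures \<Omega>"
      "P' \<in> finite_borel_measures \<Omega>" "N' \<in> finite_borel_measures \<Omega>"
    and f: "f = (\<lambda>x\<in>X. (\<integral>w. \<phi> x w \<partial>P) - (\<integral>w. \<phi> x w \<partial>N))" "m = measure P \<Omega> + measure N \<Omega>"
    and g: "g = (\<lambda>x\<in>X. (\<integral>w. \<phi> x w \<partial>P') - (\<integral>w. \<phi> x w \<partial>N'))" "n = measure P' \<Omega> + measure N' \<Omega>"
    by (auto simp: representation_costs_def)
  have "sets P' = sets P" "sets N' = sets N"
    using PN by (auto simp: finite_borel_measures_def)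
  then have "(\<lambda>x\<in>X. f x + g x) =
      (\<lambda>x\<in>X. (\<integral>w. \<phi> x w \<partial>add_measure P P') - (\<integral>w. \<phi> x w \<partial>add_measure N N'))"
    using PN by (intro restrict_ext) (simp add: f g integral_add_measure kernel_integrable)
  then show "m + n \<in> representation_costs X \<Omega> \<phi> (\<lambda>x\<in>X. f x + g x)"
    using add_measure_finite_borel[OF PN(1,3)] add_measure_finite_borel[OF PN(2,4)]
    unfolding representation_costs_def mem_Collect_eq
    by (intro exI[of _ "add_measure P P'"] exI[of _ "add_measure N N'"]) (auto simp: f g)
next
  fix c f m assume "m \<in> representation_costs X \<Omega> \<phi> f"
  then obtain P N where PN: "P \<in> finite_borel_measures \<Omega>" "N \<in> finite_borel_measures \<Omega>"
    and f: "f = (\<lambda>x\<in>X. (\<integral>w. \<phi> x w \<partial>P) - (\<integral>w. \<phi> x w \<partial>N))" "m = measure P \<Omega> + measure N \<Omega>"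
    by (auto simp: representation_costs_def)
  \<comment> \<open>A density must be nonnegative, so \<open>\<bar>c\<bar>\<close> scales the parts,
    and for negative \<open>c\<close> the two parts are exchanged.\<close>
  let ?c = "\<lambda>M. density M (\<lambda>_. ennreal \<bar>c\<bar>)"
  have int: "(\<integral>w. \<phi> x w \<partial>?c M) = \<bar>c\<bar> * (\<integral>w. \<phi> x w \<partial>M)" if "M \<in> finite_borel_measures \<Omega>" "x \<in> X" for M x
    using kernel_integrable[OF that] by (subst integral_density) auto
  have PN': "?c P \<in> finite_borel_measures \<Omega>" "?c N \<in> finite_borel_measures \<Omega>"
    "\<bar>c\<bar> * m = measure (?c P) \<Omega> + measure (?c N) \<Omega>"
    using PN by (auto simp: density_const_finite_borel f distrib_left)
  show "\<bar>c\<bar> * m \<in> representation_costs X \<Omega> \<phi> (\<lambda>x\<in>X. c * f x)"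
  proof (cases "0 \<le> c")
    case True
    then have "(\<lambda>x\<in>X. c * f x) = (\<lambda>x\<in>X. (\<integral>w. \<phi> x w \<partial>?c P) - (\<integral>w. \<phi> x w \<partial>?c N))"
      by (intro restrict_ext) (simp only: int PN f, simp add: algebra_simps)
    then show ?thesis
      using PN' unfolding representation_costs_def by blast
  next
    case False
    then have "(\<lambda>x\<in>X. c * f x) = (\<lambda>x\<in>X. (\<integral>w. \<phi> x w \<partial>?c N) - (\<integral>w. \<phi> x w \<partial>?c P))"
      by (intro restrict_ext) (simp only: int PN f, simp add: algebra_simps)
    moreover have "\<bar>c\<bar> * m = measure (?c N) \<Omega> + measure (?c P) \<Omega>"
      using PN'(3) by simp
    ultimately show ?thesis
      using PN' unfolding representation_costs_def by blast
  qed
next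
  fix f m x assume "m \<in> representation_costs X \<Omega> \<phi> f" and x: "x \<in> X"
  then obtain P N where PN: "P \<in> finite_borel_measures \<Omega>" "N \<in> finite_borel_measures \<Omega>"
    and f: "f = (\<lambda>x\<in>X. (\<integral>w. \<phi> x w \<partial>P) - (\<integral>w. \<phi> x w \<partial>N))" "m = measure P \<Omega> + measure N \<Omega>"
    by (auto simp: representation_costs_def)
  show "\<bar>f x\<bar> \<le> K x * m"
    using abs_integral_finite_borel_le[OF PN(1) kernel_measurable[OF x] kernel_bound[OF x]]
      abs_integral_finite_borel_le[OF PN(2) kernel_measurable[OF x] kernel_bound[OF x]] x
    by (simp add: f distrib_left)
qed (auto simp: representation_costs_def)

section \<open>Comparison with the integral RKBS\<close>

lemma rkbs_cost_imp_representation_cost: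
  assumes "\<mu> \<in> signed_radon_measures \<Omega>"
  shows "variation_norm \<Omega> \<mu> \<in> representation_costs X \<Omega> \<phi> (rkbs_map X \<Omega> \<phi> \<mu>)"
proof -
  interpret finite_signed_measure \<Omega> \<mu>
    using assms by (rule signed_radon_imp_finite_signed_measure)
  show ?thesis
    using positive_part_finite_borel negative_part_finite_borel variation_norm_eq
    by (auto simp: representation_costs_def rkbs_map_def signed_integral_def)
qed

text \<open>The signed measure is \<open>P - N\<close>. Cancellation between the parts can make its
  variation norm smaller than \<open>m\<close>, so only an inequality is available.\<close>

lemma representation_cost_imp_rkbs_cost:
  assumes "m \<in> representation_costs X \<Omega> \<phi> f"
  obtains \<mu> where "\<mu> \<in> signed_radon_measures \<Omega>" "f = rkbs_map X \<Omega> \<phi> \<mu>" "variation_norm \<Omega> \<mu> \<le> m"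
proof -
  obtain P N where PN: "P \<in> finite_borel_measures \<Omega>" "N \<in> finite_borel_measures \<Omega>"
    and f: "f = (\<lambda>x\<in>X. (\<integral>w. \<phi> x w \<partial>P) - (\<integral>w. \<phi> x w \<partial>N))" "m = measure P \<Omega> + measure N \<Omega>"
    using assms by (auto simp: representation_costs_def)
  let ?\<mu> = "\<lambda>A. measure P A - measure N A"
  show thesis
  proof (rule that[of ?\<mu>])
    show "?\<mu> \<in> signed_radon_measures \<Omega>"
      using finite_signed_measure_diff[OF PN] closed by (intro finite_signed_measure_imp_signed_radon) auto
    show "f = rkbs_map X \<Omega> \<phi> ?\<mu>"
      unfolding f rkbs_map_def
      by (intro restrict_ext) (use signed_integral_diff[OF PN _ kernel_measurable kernel_bound] in auto)
    show "variation_norm \<Omega> ?\<mu> \<le> m"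
      using variation_norm_diff_le[OF PN] by (simp add: f)
  qed
qed

lemma rkbs_eq: "rkbs X \<Omega> \<phi> = {f. representation_costs X \<Omega> \<phi> f \<noteq> {}}"
proof (intro equalityI subsetI CollectI)
  fix f assume "f \<in> rkbs X \<Omega> \<phi>"
  then show "representation_costs X \<Omega> \<phi> f \<noteq> {}"
    using rkbs_cost_imp_representation_cost by (auto simp: rkbs_def)
next
  fix f assume "f \<in> {f. representation_costs X \<Omega> \<phi> f \<noteq> {}}"
  then obtain m where "m \<in> representation_costs X \<Omega> \<phi> f"
    by blast
  then show "f \<in> rkbs X \<Omega> \<phi>"
    by (rule representation_cost_imp_rkbs_cost) (auto simp: rkbs_def)
qed

text \<open>Every variation norm is a cost, and every cost dominates the variation norm of some
  representing measure; this is enough for equal infima.\<close>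

lemma rkbs_norm_eq:
  assumes "f \<in> rkbs X \<Omega> \<phi>"
  shows "rkbs_norm X \<Omega> \<phi> f = Inf (representation_costs X \<Omega> \<phi> f)"
  unfolding rkbs_norm_def
proof (rule antisym)
  show "(INF \<mu>\<in>{\<mu> \<in> signed_radon_measures \<Omega>. f = rkbs_map X \<Omega> \<phi> \<mu>}. variation_norm \<Omega> \<mu>)
      \<le> Inf (representation_costs X \<Omega> \<phi> f)"
  proof (rule cInf_greatest)
    fix m assume "m \<in> representation_costs X \<Omega> \<phi> f"
    then obtain \<mu> where \<mu>: "\<mu> \<in> signed_radon_measures \<Omega>" "f = rkbs_map X \<Omega> \<phi> \<mu>" "variation_norm \<Omega> \<mu> \<le> m"
      by (rule representation_cost_imp_rkbs_cost)
    have "bdd_below (variation_norm \<Omega> ` S)" for S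
      by (intro bdd_belowI[of _ 0]) (auto simp: variation_norm_def)
    then show "(INF \<mu>\<in>{\<mu> \<in> signed_radon_measures \<Omega>. f = rkbs_map X \<Omega> \<phi> \<mu>}. variation_norm \<Omega> \<mu>) \<le> m"
      using \<mu> by (intro cINF_lower2[of _ _ \<mu>]) auto
  qed (use assms rkbs_eq in auto)
  show "Inf (representation_costs X \<Omega> \<phi> f)
      \<le> (INF \<mu>\<in>{\<mu> \<in> signed_radon_measures \<Omega>. f = rkbs_map X \<Omega> \<phi> \<mu>}. variation_norm \<Omega> \<mu>)"
  proof (rule cINF_greatest)
    have "bdd_below (representation_costs X \<Omega> \<phi> f)"
      by (intro bdd_belowI[of _ 0]) (auto simp: representation_costs_def)
    then show "Inf (representation_costs X \<Omega> \<phi> f) \<le> variation_norm \<Omega> \<mu>"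
      if "\<mu> \<in> {\<mu> \<in> signed_radon_measures \<Omega>. f = rkbs_map X \<Omega> \<phi> \<mu>}" for \<mu>
      using that rkbs_cost_imp_representation_cost[of \<mu>] by (intro cInf_lower) auto
  qed (use assms in \<open>auto simp: rkbs_def\<close>)
qed

end

subsection \<open>Barron measures\<close>

definition barron_weight :: "(real^'d) \<times> real \<Rightarrow> real" where
  "barron_weight w = 1 + l1_norm (fst w) + \<bar>snd w\<bar>"

lemma l1_norm_nonneg: "0 \<le> l1_norm v"
  by (simp add: l1_norm_def sum_nonneg)

lemma barron_weight_ge_1: "1 \<le> barron_weight w"
  using l1_norm_nonneg[of "fst w"] by (simp add: barron_weight_def)

lemma barron_weight_pos [simp]: "0 < barron_weight w" "barron_weight w \<noteq> 0" "0 \<le> barron_weight w"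
  using barron_weight_ge_1[of w] by linarith+

lemma barron_integrand_eq: "barron_integrand z = \<bar>fst z\<bar> * barron_weight (snd z)"
  by (simp add: barron_integrand_def barron_weight_def case_prod_beta)

lemma barron_kernel_eq: "barron_kernel \<sigma> x w = \<sigma> (fst w \<bullet> x + snd w) / barron_weight w"
  by (simp add: barron_kernel_def barron_weight_def case_prod_beta field_simps)

lemma continuous_on_barron_weight [continuous_intros]: "continuous_on S barron_weight"
  unfolding barron_weight_def l1_norm_def by (intro continuous_intros)

lemma measurable_barron_weight [measurable]: "barron_weight \<in> borel_measurable borel"
  by (intro borel_measurable_continuous_onI continuous_intros)

lemma continuous_on_barron_kernel:
  assumes "continuous_on UNIV \<sigma>"
  shows "continuous_on S (barron_kernel \<sigma> x)"
proof -
  have "continuous_on S (\<lambda>w. \<sigma> (fst w \<bullet> x + snd w) / barron_weight w)"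
    by (intro continuous_intros continuous_on_compose2[OF assms]) auto
  then show ?thesis by (simp add: barron_kernel_eq[abs_def])
qed

lemma measurable_barron_kernel:
  "continuous_on UNIV \<sigma> \<Longrightarrow> barron_kernel \<sigma> x \<in> borel_measurable borel"
  by (intro borel_measurable_continuous_onI continuous_on_barron_kernel)

text \<open>Beyond some radius the growth condition applies, and within it continuity on a compact
  interval; the summand \<open>1\<close> absorbs the second bound.\<close>

lemma linear_growth_bound:
  fixes \<sigma> :: "real \<Rightarrow> real"
  assumes \<sigma>: "continuous_on UNIV \<sigma>" and growth: "\<sigma> \<in> O[at_infinity](\<lambda>y. y)"
  obtains C where "0 \<le> C" "\<And>y. \<bar>\<sigma> y\<bar> \<le> C * (1 + \<bar>y\<bar>)"
proof -
  obtain c where c: "c > 0" "eventually (\<lambda>y. norm (\<sigma> y) \<le> c * norm y) at_infinity"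
    using growth by (auto elim: landau_o.bigE)
  then obtain R where R: "\<And>y. R \<le> \<bar>y\<bar> \<Longrightarrow> \<bar>\<sigma> y\<bar> \<le> c * \<bar>y\<bar>"
    by (auto simp: eventually_at_infinity)
  have "bounded (\<sigma> ` {-R..R})"
    by (intro compact_imp_bounded compact_continuous_image continuous_on_subset[OF \<sigma>]) auto
  then obtain B where B: "\<And>y. y \<in> {-R..R} \<Longrightarrow> \<bar>\<sigma> y\<bar> \<le> B"
    unfolding bounded_iff by (metis imageI real_norm_def)
  \<comment> \<open>\<open>\<bar>B\<bar>\<close> is taken because \<open>B\<close> may be negative:
    for \<open>R < 0\<close> the interval is empty.\<close>
  have "\<bar>\<sigma> y\<bar> \<le> (c + \<bar>B\<bar>) * (1 + \<bar>y\<bar>)" for y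
  proof -
    have nn: "0 \<le> c * \<bar>y\<bar>" "0 \<le> \<bar>B\<bar> * \<bar>y\<bar>" using c by auto
    show ?thesis
    proof (cases "R \<le> \<bar>y\<bar>")
      case True
      then have "\<bar>\<sigma> y\<bar> \<le> c * \<bar>y\<bar>" by (rule R)
      then show ?thesis using c(1) nn unfolding distrib_left distrib_right by linarith
    next
      case False
      then have "\<bar>\<sigma> y\<bar> \<le> B" by (intro B) auto
      then show ?thesis using c(1) nn unfolding distrib_left distrib_right by linarith
    qed
  qed
  then show thesis using c(1) that[of "c + \<bar>B\<bar>"] by simp
qed

text \<open>On compact \<open>\<Omega>\<close> continuity suffices. Under linear growth, the
  Cauchy-Schwarz inequality and the domination of the Euclidean norm by the l1 norm give \<open>1 +
  \<bar>v \<bullet> x + b\<bar> \<le> (1 + norm x) * barron_weight (v, b)\<close>, and the weight in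
  the denominator cancels.\<close>

lemma barron_kernel_bounded:
  fixes \<Omega> :: "((real^'d) \<times> real) set"
  assumes \<sigma>: "continuous_on UNIV \<sigma>" and "compact \<Omega> \<or> \<sigma> \<in> O[at_infinity](\<lambda>y. y)"
  shows "\<exists>K. \<forall>w\<in>\<Omega>. \<bar>barron_kernel \<sigma> x w\<bar> \<le> K"
  using assms(2)
proof
  assume "compact \<Omega>"
  then have "bounded (barron_kernel \<sigma> x ` \<Omega>)"
    by (intro compact_imp_bounded compact_continuous_image continuous_on_barron_kernel \<sigma>)
  then show ?thesis by (auto simp: bounded_iff)
next
  assume "\<sigma> \<in> O[at_infinity](\<lambda>y. y)"
  then obtain C where C: "0 \<le> C" "\<And>y. \<bar>\<sigma> y\<bar> \<le> C * (1 + \<bar>y\<bar>)"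
    using linear_growth_bound[OF \<sigma>] by blast
  have "\<bar>barron_kernel \<sigma> x w\<bar> \<le> C * (1 + norm x)" for w
  proof -
    have "\<bar>fst w \<bullet> x\<bar> \<le> norm (fst w) * norm x"
      by (rule Cauchy_Schwarz_ineq2)
    also have "\<dots> \<le> l1_norm (fst w) * norm x"
      using norm_le_l1_cart[of "fst w"] by (intro mult_right_mono) (auto simp: l1_norm_def)
    finally have v: "\<bar>fst w \<bullet> x\<bar> \<le> l1_norm (fst w) * norm x" .
    have "1 + \<bar>fst w \<bullet> x + snd w\<bar> \<le> 1 + l1_norm (fst w) * norm x + \<bar>snd w\<bar>"
      using v by linarith
    also have "\<dots> \<le> (1 + norm x) * barron_weight w"
      using l1_norm_nonneg[of "fst w"] by (simp add: barron_weight_def algebra_simps)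
    finally have "\<bar>\<sigma> (fst w \<bullet> x + snd w)\<bar> \<le> C * ((1 + norm x) * barron_weight w)"
      using C(2)[of "fst w \<bullet> x + snd w"] mult_left_mono[OF _ C(1)] by (meson order.trans)
    then show ?thesis
      by (simp add: barron_kernel_eq divide_le_eq mult.assoc)
  qed
  then show ?thesis by blast
qed

section \<open>Transport between Barron measures and measures on the weights\<close>

text \<open>\<open>s = 1\<close> selects the positive part of the coefficient \<open>a\<close>, and
  \<open>s = -1\<close> its negative part. Multiplying by the weight turns Barron costs into
  masses.\<close>

definition barron_projection ::
    "((real^'d) \<times> real) set \<Rightarrow> (real \<times> (real^'d) \<times> real) measure \<Rightarrow> real \<Rightarrow> ((real^'d) \<times> real) measure" where
  "barron_projection \<Omega> \<pi> s =
     distr (density \<pi> (\<lambda>z. ennreal (max 0 (s * fst z) * barron_weight (snd z)))) (borel_on \<Omega>) snd"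

text \<open>All mass over \<open>w\<close> is put at the coefficient
  \<open>c / barron_weight w\<close>, so that coefficient times weight is the constant
  \<open>c\<close>.\<close>

definition barron_lift ::
    "((real^'d) \<times> real) set \<Rightarrow> ((real^'d) \<times> real) measure \<Rightarrow> real \<Rightarrow> (real \<times> (real^'d) \<times> real) measure" where
  "barron_lift \<Omega> Q c = distr Q (borel_on (UNIV \<times> \<Omega>)) (\<lambda>w. (c / barron_weight w, w))"

context
  fixes \<Omega> :: "((real^'d) \<times> real) set" and \<pi> :: "(real \<times> (real^'d) \<times> real) measure"
  assumes \<pi>: "\<pi> \<in> barron_measures \<Omega>"
begin

lemma sets_barron_measure: "sets \<pi> = sets (borel_on (UNIV \<times> \<Omega>))"
  using \<pi> by (simp add: barron_measures_def borel_prob_measures_def)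

lemma space_barron_measure: "space \<pi> = UNIV \<times> \<Omega>"
  using sets_eq_imp_space_eq[OF sets_barron_measure] by (simp add: space_restrict_space)

lemma borel_measurable_barron_measure:
  "f \<in> borel_measurable borel \<Longrightarrow> f \<in> borel_measurable \<pi>"
  by (simp add: measurable_cong_sets[OF sets_barron_measure refl] measurable_restrict_space1)

lemma measurable_snd_barron_measure: "snd \<in> measurable \<pi> (borel_on \<Omega>)"
proof (rule measurable_restrict_space2)
  show "snd \<in> space \<pi> \<rightarrow> \<Omega>"
    by (auto simp: space_barron_measure)
  have "snd \<in> borel_measurable (borel :: (real \<times> (real^'d) \<times> real) measure)"
    by (intro borel_measurable_continuous_onI continuous_intros)
  then show "snd \<in> borel_measurable \<pi>"
    by (rule borel_measurable_barron_measure)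
qed

lemma measurable_fst_barron_measure: "fst \<in> borel_measurable \<pi>"
proof (rule borel_measurable_barron_measure)
  show "fst \<in> borel_measurable (borel :: (real \<times> (real^'d) \<times> real) measure)"
    by (intro borel_measurable_continuous_onI continuous_intros)
qed

lemma measurable_barron_density:
  "(\<lambda>z. max 0 (s * fst z) * barron_weight (snd z)) \<in> borel_measurable \<pi>"
proof -
  have "(\<lambda>z. barron_weight (snd z)) \<in> borel_measurable \<pi>"
    by (rule measurable_compose[OF measurable_snd_barron_measure])
      (simp add: measurable_restrict_space1)
  then show ?thesis
    using measurable_fst_barron_measure by measurable
qed

lemma integrable_barron_integrand: "integrable \<pi> (\<lambda>z. \<bar>fst z\<bar> * barron_weight (snd z))"
  using \<pi> by (simp add: barron_measures_def barron_integrand_eq[abs_def])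

lemma integrable_barron_density:
  assumes "\<bar>s\<bar> \<le> 1"
  shows "integrable \<pi> (\<lambda>z. max 0 (s * fst z) * barron_weight (snd z))"
proof (rule Bochner_Integration.integrable_bound[OF integrable_barron_integrand measurable_barron_density])
  have "max 0 (s * a) \<le> \<bar>a\<bar>" for a
  proof -
    have "s * a \<le> \<bar>s\<bar> * \<bar>a\<bar>" by (simp flip: abs_mult)
    also have "\<dots> \<le> \<bar>a\<bar>" using assms by (simp add: mult_left_le_one_le)
    finally show ?thesis by simp
  qed
  then show "AE z in \<pi>. norm (max 0 (s * fst z) * barron_weight (snd z)) \<le> norm (\<bar>fst z\<bar> * barron_weight (snd z))"
    by (intro AE_I2) (simp add: abs_mult mult_right_mono)
qed

lemma integral_barron_projection:
  assumes "f \<in> borel_measurable (borel_on \<Omega>)"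
  shows "(\<integral>w. f w \<partial>barron_projection \<Omega> \<pi> s) =
    (\<integral>z. max 0 (s * fst z) * barron_weight (snd z) * f (snd z) \<partial>\<pi>)"
  unfolding barron_projection_def
  using assms measurable_snd_barron_measure measurable_barron_density[of s]
    measurable_compose[OF measurable_snd_barron_measure assms]
  by (subst integral_distr) (auto simp: integral_density)

lemma
  assumes s: "\<bar>s\<bar> \<le> 1"
  shows barron_projection_finite_borel: "barron_projection \<Omega> \<pi> s \<in> finite_borel_measures \<Omega>"
    and measure_barron_projection:
      "measure (barron_projection \<Omega> \<pi> s) \<Omega> = (\<integral>z. max 0 (s * fst z) * barron_weight (snd z) \<partial>\<pi>)"
proof -
  have e: "emeasure (barron_projection \<Omega> \<pi> s) \<Omega> =
      ennreal (\<integral>z. max 0 (s * fst z) * barron_weight (snd z) \<partial>\<pi>)"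
  proof -
    have "emeasure (barron_projection \<Omega> \<pi> s) \<Omega> =
        emeasure (density \<pi> (\<lambda>z. ennreal (max 0 (s * fst z) * barron_weight (snd z)))) (space \<pi>)"
      using measurable_snd_barron_measure
      by (auto simp: barron_projection_def emeasure_distr space_barron_measure
          intro!: arg_cong2[where f = emeasure])
    also have "\<dots> = (\<integral>\<^sup>+z. ennreal (max 0 (s * fst z) * barron_weight (snd z)) \<partial>\<pi>)"
      using measurable_barron_density[of s] by (subst emeasure_density) (auto intro!: nn_integral_cong)
    also have "\<dots> = ennreal (\<integral>z. max 0 (s * fst z) * barron_weight (snd z) \<partial>\<pi>)"
      by (rule nn_integral_eq_integral[OF integrable_barron_density[OF s]]) simp
    finally show ?thesis .
  qed
  have "space (barron_projection \<Omega> \<pi> s) = \<Omega>"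
    by (simp add: barron_projection_def space_restrict_space)
  \<comment> \<open>The definition is unfolded only under \<open>sets\<close>, so that
    \<open>e\<close> still applies.\<close>
  with e show "barron_projection \<Omega> \<pi> s \<in> finite_borel_measures \<Omega>"
    by (auto simp: finite_borel_measures_def barron_projection_def[THEN arg_cong[where f = sets]]
        intro!: finite_measureI)
  show "measure (barron_projection \<Omega> \<pi> s) \<Omega> = (\<integral>z. max 0 (s * fst z) * barron_weight (snd z) \<partial>\<pi>)"
    by (simp add: measure_def e integral_nonneg_AE)
qed

end

context
  fixes \<Omega> :: "((real^'d) \<times> real) set" and Q :: "((real^'d) \<times> real) measure"
  assumes Q: "Q \<in> finite_borel_measures \<Omega>"
begin

lemma measurable_barron_lift:
  "(\<lambda>w. (c / barron_weight w, w)) \<in> measurable Q (borel_on (UNIV \<times> \<Omega>))"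
proof (rule measurable_restrict_space2)
  show "(\<lambda>w. (c / barron_weight w, w)) \<in> space Q \<rightarrow> UNIV \<times> \<Omega>"
    using space_finite_borel_measures[OF Q] by auto
  have s: "sets Q = sets (borel_on \<Omega>)"
    using Q by (simp add: finite_borel_measures_def)
  have "(\<lambda>w. (c / barron_weight w, w)) \<in> borel_measurable (borel :: ((real^'d) \<times> real) measure)"
    by (intro borel_measurable_continuous_onI continuous_intros) auto
  then show "(\<lambda>w. (c / barron_weight w, w)) \<in> borel_measurable Q"
    by (simp add: measurable_cong_sets[OF s refl] measurable_restrict_space1)
qed

lemma
  shows barron_lift_finite_borel: "barron_lift \<Omega> Q c \<in> finite_borel_measures (UNIV \<times> \<Omega>)"
    and measure_barron_lift: "measure (barron_lift \<Omega> Q c) (UNIV \<times> \<Omega>) = measure Q \<Omega>"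
proof -
  interpret finite_measure Q using Q by (simp add: finite_borel_measures_def)
  show "barron_lift \<Omega> Q c \<in> finite_borel_measures (UNIV \<times> \<Omega>)"
    using finite_measure_distr[OF measurable_barron_lift] by (simp add: barron_lift_def finite_borel_measures_def)
  have "(\<lambda>w. (c / barron_weight w, w)) -` (UNIV \<times> \<Omega>) \<inter> space Q = \<Omega>"
    using space_finite_borel_measures[OF Q] by auto
  then show "measure (barron_lift \<Omega> Q c) (UNIV \<times> \<Omega>) = measure Q \<Omega>"
    using measurable_barron_lift[of c] by (simp add: barron_lift_def measure_distr)
qed

text \<open>The lifted measure is concentrated on the points
  \<open>(c / barron_weight w, w)\<close>. There \<open>f\<close> equals the bounded function
  \<open>g\<close>, so it is integrable even if it is unbounded elsewhere.\<close>

lemma has_integral_barron_lift: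
  fixes f :: "real \<times> (real^'d) \<times> real \<Rightarrow> real" and g :: "(real^'d) \<times> real \<Rightarrow> real"
  assumes f: "f \<in> borel_measurable borel"
    and g: "g \<in> borel_measurable borel" "\<And>w. w \<in> \<Omega> \<Longrightarrow> \<bar>g w\<bar> \<le> K"
    and fg: "\<And>w. w \<in> \<Omega> \<Longrightarrow> f (c / barron_weight w, w) = g w"
  shows "has_bochner_integral (barron_lift \<Omega> Q c) f (\<integral>w. g w \<partial>Q)"
proof -
  have "f \<in> borel_measurable (borel_on (UNIV \<times> \<Omega>))"
    using f by (rule measurable_restrict_space1)
  moreover have "has_bochner_integral Q (\<lambda>w. f (c / barron_weight w, w)) (\<integral>w. g w \<partial>Q)
      \<longleftrightarrow> has_bochner_integral Q g (\<integral>w. g w \<partial>Q)"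
    by (rule has_bochner_integral_cong) (use fg space_finite_borel_measures[OF Q] in auto)
  moreover have "integrable Q g"
    using Q g by (intro integrable_finite_borel) (auto intro: measurable_restrict_space1)
  ultimately show ?thesis
    unfolding barron_lift_def
    by (intro has_bochner_integral_distr measurable_barron_lift) (auto intro: has_bochner_integral_integrable)
qed

end

section \<open>Comparison with the Barron space\<close>

definition barron_costs ::
    "(real^'d) set \<Rightarrow> ((real^'d) \<times> real) set \<Rightarrow> (real \<Rightarrow> real) \<Rightarrow> (real^'d \<Rightarrow> real) \<Rightarrow> real set" where
  "barron_costs X \<Omega> \<sigma> f =
     (\<lambda>\<pi>. \<integral>z. barron_integrand z \<partial>\<pi>) ` {\<pi> \<in> barron_measures \<Omega>. f = barron_map X \<sigma> \<pi>}"

text \<open>The activation is weight times kernel, since the weight never vanishes.\<close>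

lemma barron_map_eq:
  "barron_map X \<sigma> \<pi> = (\<lambda>x\<in>X. \<integral>z. fst z * barron_weight (snd z) * barron_kernel \<sigma> x (snd z) \<partial>\<pi>)"
  by (simp add: barron_map_def barron_kernel_eq case_prod_unfold)

text \<open>For empty \<open>\<Omega>\<close> there would be no probability measure on
  \<open>UNIV \<times> \<Omega>\<close> and \<open>barron_space\<close> would be empty, whereas
  \<open>rkbs\<close> would still contain the zero function; hence
  \<open>weights_nonempty\<close>.\<close>

locale barron =
  fixes X :: "(real^'d) set" and \<Omega> :: "((real^'d) \<times> real) set" and \<sigma> :: "real \<Rightarrow> real"
    and K :: "real^'d \<Rightarrow> real"
  assumes closed_weights: "closed \<Omega>" and weights_nonempty: "\<Omega> \<noteq> {}"
    and continuous_activation: "continuous_on UNIV \<sigma>"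
    and barron_kernel_le: "\<And>x w. w \<in> \<Omega> \<Longrightarrow> \<bar>barron_kernel \<sigma> x w\<bar> \<le> K x"

sublocale barron \<subseteq> bounded_kernel X \<Omega> "barron_kernel \<sigma>" K
proof
  show "barron_kernel \<sigma> x \<in> borel_measurable (borel_on \<Omega>)" for x
    by (rule measurable_restrict_space1[OF measurable_barron_kernel[OF continuous_activation]])
qed (use closed_weights barron_kernel_le in blast)+

context barron
begin

text \<open>The identity \<open>max 0 a + max 0 (- a) = \<bar>a\<bar>\<close> turns the two masses
  into the Barron cost, and \<open>max 0 a - max 0 (- a) = a\<close> turns the two kernel integrals
  into the Barron map.\<close>

lemma barron_cost_imp_representation_cost:
  assumes \<pi>: "\<pi> \<in> barron_measures \<Omega>"
  shows "(\<integral>z. barron_integrand z \<partial>\<pi>) \<in> representation_costs X \<Omega> (barron_kernel \<sigma>) (barron_map X \<sigma> \<pi>)"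
proof -
  let ?P = "barron_projection \<Omega> \<pi> 1" and ?N = "barron_projection \<Omega> \<pi> (-1)"
  let ?d = "\<lambda>s z. max 0 (s * fst z) * barron_weight (snd z)"
  have split: "max 0 a + max 0 (- a) = \<bar>a\<bar>" "max 0 a - max 0 (- a) = a" for a :: real
    by auto
  have "(\<integral>z. barron_integrand z \<partial>\<pi>) = (\<integral>z. ?d 1 z + ?d (-1) z \<partial>\<pi>)"
    by (simp add: barron_integrand_eq split flip: distrib_right)
  also have "\<dots> = measure ?P \<Omega> + measure ?N \<Omega>"
    by (simp add: measure_barron_projection[OF \<pi>] integrable_barron_density[OF \<pi>, of 1, simplified]
        integrable_barron_density[OF \<pi>, of "-1", simplified])
  finally have cost: "(\<integral>z. barron_integrand z \<partial>\<pi>) = measure ?P \<Omega> + measure ?N \<Omega>" .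
  have "barron_map X \<sigma> \<pi> = (\<lambda>x\<in>X. (\<integral>w. barron_kernel \<sigma> x w \<partial>?P) - (\<integral>w. barron_kernel \<sigma> x w \<partial>?N))"
    unfolding barron_map_eq
  proof (rule restrict_ext)
    fix x assume x: "x \<in> X"
    have m: "(\<lambda>z. barron_kernel \<sigma> x (snd z)) \<in> borel_measurable \<pi>"
      by (rule measurable_compose[OF measurable_snd_barron_measure[OF \<pi>] kernel_measurable[OF x]])
    \<comment> \<open>The integrands are dominated by \<open>K x\<close> times an integrable
      density, which allows the two integrals to be joined.\<close>
    have int: "integrable \<pi> (\<lambda>z. ?d s z * barron_kernel \<sigma> x (snd z))" if s: "\<bar>s\<bar> \<le> 1" for s
    proof (rule Bochner_Integration.integrable_bound[OF integrable_mult_right[OF integrable_barron_density[OF \<pi> s], of "K x"]])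
      show "AE z in \<pi>. norm (?d s z * barron_kernel \<sigma> x (snd z)) \<le> norm (K x * ?d s z)"
      proof (rule AE_I2)
        fix z assume "z \<in> space \<pi>"
        then have "\<bar>barron_kernel \<sigma> x (snd z)\<bar> \<le> \<bar>K x\<bar>"
          using kernel_bound[OF x, of "snd z"] by (auto simp: space_barron_measure[OF \<pi>])
        then have "\<bar>?d s z\<bar> * \<bar>barron_kernel \<sigma> x (snd z)\<bar> \<le> \<bar>?d s z\<bar> * \<bar>K x\<bar>"
          by (intro mult_left_mono) auto
        then show "norm (?d s z * barron_kernel \<sigma> x (snd z)) \<le> norm (K x * ?d s z)"
          by (simp add: abs_mult mult.commute)
      qed
    qed (use m measurable_barron_density[OF \<pi>, of s] in measurable)
    have "(\<integral>w. barron_kernel \<sigma> x w \<partial>?P) - (\<integral>w. barron_kernel \<sigma> x w \<partial>?N)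
        = (\<integral>z. ?d 1 z * barron_kernel \<sigma> x (snd z) - ?d (-1) z * barron_kernel \<sigma> x (snd z) \<partial>\<pi>)"
      unfolding integral_barron_projection[OF \<pi> kernel_measurable[OF x]]
      by (rule Bochner_Integration.integral_diff[symmetric]) (intro int; simp)+
    also have "\<dots> = (\<integral>z. fst z * barron_weight (snd z) * barron_kernel \<sigma> x (snd z) \<partial>\<pi>)"
      by (simp add: split flip: left_diff_distrib)
    finally show "(\<integral>z. fst z * barron_weight (snd z) * barron_kernel \<sigma> x (snd z) \<partial>\<pi>)
        = (\<integral>w. barron_kernel \<sigma> x w \<partial>?P) - (\<integral>w. barron_kernel \<sigma> x w \<partial>?N)" by simp
  qed
  with cost show ?thesis
    using barron_projection_finite_borel[OF \<pi>, of 1] barron_projection_finite_borel[OF \<pi>, of "-1"]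
    by (auto simp: representation_costs_def)
qed

lemma barron_measuresI:
  assumes "\<pi> \<in> finite_borel_measures (UNIV \<times> \<Omega>)" "measure \<pi> (UNIV \<times> \<Omega>) = 1" "integrable \<pi> barron_integrand"
  shows "\<pi> \<in> barron_measures \<Omega>"
proof -
  interpret finite_measure \<pi> using assms by (simp add: finite_borel_measures_def)
  have "prob_space \<pi>"
    using assms(2) space_finite_borel_measures[OF assms(1)] by (intro prob_spaceI) (simp add: emeasure_eq_measure)
  then show ?thesis
    using assms by (simp add: barron_measures_def borel_prob_measures_def finite_borel_measures_def)
qed

text \<open>On the lift, coefficient times weight equals \<open>c\<close>; hence the Barron
  integrand is the constant \<open>\<bar>c\<bar>\<close> there, and the integrand of the Barron map
  is \<open>c\<close> times the kernel.\<close>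

lemma
  assumes Q: "Q \<in> finite_borel_measures \<Omega>"
  shows barron_integrand_barron_lift:
      "has_bochner_integral (barron_lift \<Omega> Q c) barron_integrand (\<bar>c\<bar> * measure Q \<Omega>)"
    and kernel_barron_lift:
      "x \<in> X \<Longrightarrow> has_bochner_integral (barron_lift \<Omega> Q c)
         (\<lambda>z. fst z * barron_weight (snd z) * barron_kernel \<sigma> x (snd z)) (c * (\<integral>w. barron_kernel \<sigma> x w \<partial>Q))"
proof -
  note [continuous_intros] =
    continuous_on_compose2[OF continuous_on_barron_weight[of UNIV] _ subset_UNIV]
    continuous_on_compose2[OF continuous_on_barron_kernel[OF continuous_activation, of UNIV] _ subset_UNIV]
  have "has_bochner_integral (barron_lift \<Omega> Q c) barron_integrand (\<integral>w. \<bar>c\<bar> \<partial>Q)"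
    unfolding barron_integrand_eq[abs_def]
    by (rule has_integral_barron_lift[OF Q, where K = "\<bar>c\<bar>"])
      (auto intro!: borel_measurable_continuous_onI continuous_intros)
  then show "has_bochner_integral (barron_lift \<Omega> Q c) barron_integrand (\<bar>c\<bar> * measure Q \<Omega>)"
    using space_finite_borel_measures[OF Q] by (simp add: mult.commute)
  assume x: "x \<in> X"
  have "has_bochner_integral (barron_lift \<Omega> Q c)
      (\<lambda>z. fst z * barron_weight (snd z) * barron_kernel \<sigma> x (snd z)) (\<integral>w. c * barron_kernel \<sigma> x w \<partial>Q)"
  proof (rule has_integral_barron_lift[OF Q, where K = "\<bar>c\<bar> * K x"])
    show "\<bar>c * barron_kernel \<sigma> x w\<bar> \<le> \<bar>c\<bar> * K x" if "w \<in> \<Omega>" for w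
      using kernel_bound[OF x that] by (simp add: abs_mult mult_left_mono)
  qed (auto intro!: borel_measurable_continuous_onI continuous_intros)
  then show "has_bochner_integral (barron_lift \<Omega> Q c)
      (\<lambda>z. fst z * barron_weight (snd z) * barron_kernel \<sigma> x (snd z)) (c * (\<integral>w. barron_kernel \<sigma> x w \<partial>Q))"
    by simp
qed

lemma representation_cost_imp_barron_cost:
  assumes "m \<in> representation_costs X \<Omega> (barron_kernel \<sigma>) f"
  obtains \<pi> where "\<pi> \<in> barron_measures \<Omega>" "f = barron_map X \<sigma> \<pi>" "(\<integral>z. barron_integrand z \<partial>\<pi>) = m"
proof -
  obtain P N where PN: "P \<in> finite_borel_measures \<Omega>" "N \<in> finite_borel_measures \<Omega>"
    and f: "f = (\<lambda>x\<in>X. (\<integral>w. barron_kernel \<sigma> x w \<partial>P) - (\<integral>w. barron_kernel \<sigma> x w \<partial>N))"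
    and m: "m = measure P \<Omega> + measure N \<Omega>"
    using assms by (auto simp: representation_costs_def)
  show thesis
  proof (cases "m = 0")
    case True
    \<comment> \<open>There is no mass to normalise, so take any probability measure with \<open>a = 0\<close>.\<close>
    obtain w where w: "w \<in> \<Omega>" using weights_nonempty by blast
    let ?Q = "return (borel_on \<Omega>) w"
    let ?\<pi> = "barron_lift \<Omega> ?Q 0"
    have "prob_space ?Q"
      using w by (intro prob_space_return) (simp add: space_restrict_space)
    then interpret Q: prob_space ?Q .
    have Q: "?Q \<in> finite_borel_measures \<Omega>"
      using Q.finite_measure_axioms by (simp add: finite_borel_measures_def)
    have "measure ?Q \<Omega> = 1"
      using Q.prob_space by (simp add: space_restrict_space)
    then have \<pi>: "?\<pi> \<in> barron_measures \<Omega>"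
      using barron_lift_finite_borel[OF Q] measure_barron_lift[OF Q] barron_integrand_barron_lift[OF Q, of 0]
      by (intro barron_measuresI) (auto simp: has_bochner_integral_iff)
    \<comment> \<open>Without mass both kernel integrals vanish, so \<open>f\<close> is zero, and so
      is the map of a lift with coefficient zero.\<close>
    have PN0: "measure P \<Omega> = 0" "measure N \<Omega> = 0"
      using True m by (auto simp: add_nonneg_eq_0_iff)
    have zero: "(\<integral>w. barron_kernel \<sigma> x w \<partial>M) = 0"
      if "x \<in> X" "M \<in> finite_borel_measures \<Omega>" "measure M \<Omega> = 0" for x M
      using abs_integral_finite_borel_le[OF that(2) kernel_measurable kernel_bound] that by fastforce
    have "f = barron_map X \<sigma> ?\<pi>"
      unfolding f barron_map_eq
      by (rule restrict_ext)
        (use kernel_barron_lift[OF Q, of _ 0] zero PN PN0 in \<open>auto simp: has_bochner_integral_iff\<close>)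
    moreover have "(\<integral>z. barron_integrand z \<partial>?\<pi>) = m"
      using barron_integrand_barron_lift[OF Q, of 0] True by (auto simp: has_bochner_integral_iff)
    ultimately show ?thesis using that \<pi> by blast
  next
    case False
    then have m_pos: "0 < m" using m measure_nonneg[of P \<Omega>] measure_nonneg[of N \<Omega>] by linarith
    define P' where "P' = density P (\<lambda>_. ennreal (1 / m))"
    define N' where "N' = density N (\<lambda>_. ennreal (1 / m))"
    have PN': "P' \<in> finite_borel_measures \<Omega>" "N' \<in> finite_borel_measures \<Omega>"
      "measure P' \<Omega> = measure P \<Omega> / m" "measure N' \<Omega> = measure N \<Omega> / m"
      unfolding P'_def N'_def using PN m_pos by (auto simp: density_const_finite_borel)
    have int': "(\<integral>w. barron_kernel \<sigma> x w \<partial>P') = (\<integral>w. barron_kernel \<sigma> x w \<partial>P) / m"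
      "(\<integral>w. barron_kernel \<sigma> x w \<partial>N') = (\<integral>w. barron_kernel \<sigma> x w \<partial>N) / m" if x: "x \<in> X" for x
      unfolding P'_def N'_def using kernel_integrable[OF PN(1) x] kernel_integrable[OF PN(2) x] m_pos
      by (simp_all add: integral_density)
    \<comment> \<open>Division by \<open>m\<close> makes the total mass one. The lift constants
      \<open>m\<close> and \<open>- m\<close> undo it in the kernel integrals and supply the sign of
      the second part; the cost becomes \<open>m\<close> times the total mass one.\<close>
    define \<pi> where "\<pi> = add_measure (barron_lift \<Omega> P' m) (barron_lift \<Omega> N' (- m))"
    note lifts = barron_lift_finite_borel[OF PN'(1), of m] barron_lift_finite_borel[OF PN'(2), of "-m"]
    have sets: "sets (barron_lift \<Omega> N' (- m)) = sets (barron_lift \<Omega> P' m)"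
      using lifts by (simp add: finite_borel_measures_def)
    have sum1: "measure P \<Omega> / m + measure N \<Omega> / m = 1"
      using m m_pos by (simp flip: add_divide_distrib)
    have add_integral: "has_bochner_integral \<pi> g (a + b)"
      if "has_bochner_integral (barron_lift \<Omega> P' m) g a" "has_bochner_integral (barron_lift \<Omega> N' (- m)) g b"
      for g :: "real \<times> (real^'d) \<times> real \<Rightarrow> real" and a b
      using that integrable_add_measure[OF sets, of g] integral_add_measure[OF sets, of g]
      by (auto simp: \<pi>_def has_bochner_integral_iff)
    have cost: "has_bochner_integral \<pi> barron_integrand (m * (measure P' \<Omega> + measure N' \<Omega>))"
      using add_integral[OF barron_integrand_barron_lift[OF PN'(1)] barron_integrand_barron_lift[OF PN'(2)]] m_pos
      by (simp add: distrib_left)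
    have "\<pi> \<in> barron_measures \<Omega>"
      using add_measure_finite_borel[OF lifts] cost sum1
      by (intro barron_measuresI)
        (auto simp: \<pi>_def measure_barron_lift[OF PN'(1)] measure_barron_lift[OF PN'(2)] PN' has_bochner_integral_iff)
    moreover have "(\<integral>z. barron_integrand z \<partial>\<pi>) = m"
      using cost sum1 by (simp add: has_bochner_integral_iff PN')
    moreover have "f = barron_map X \<sigma> \<pi>"
      unfolding f barron_map_eq
    proof (rule restrict_ext)
      fix x assume x: "x \<in> X"
      show "(\<integral>w. barron_kernel \<sigma> x w \<partial>P) - (\<integral>w. barron_kernel \<sigma> x w \<partial>N) =
          (\<integral>z. fst z * barron_weight (snd z) * barron_kernel \<sigma> x (snd z) \<partial>\<pi>)"
        using add_integral[OF kernel_barron_lift[OF PN'(1) x] kernel_barron_lift[OF PN'(2) x]] m_pos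
        by (simp add: has_bochner_integral_iff int'[OF x])
    qed
    ultimately show ?thesis using that by blast
  qed
qed

text \<open>In both directions the cost is reproduced exactly, so the sets themselves agree;
  equality of spaces and norms can then be read off.\<close>

lemma barron_costs_eq: "barron_costs X \<Omega> \<sigma> f = representation_costs X \<Omega> (barron_kernel \<sigma>) f"
  using barron_cost_imp_representation_cost
  by (auto simp: barron_costs_def elim!: representation_cost_imp_barron_cost)

lemma barron_space_eq_rkbs: "barron_space X \<Omega> \<sigma> = rkbs X \<Omega> (barron_kernel \<sigma>)"
  unfolding rkbs_eq barron_costs_eq[symmetric] by (auto simp: barron_space_def barron_costs_def)

lemma barron_norm_eq: "barron_norm X \<Omega> \<sigma> f = Inf (representation_costs X \<Omega> (barron_kernel \<sigma>) f)"
  unfolding barron_costs_eq[symmetric] by (simp add: barron_norm_def barron_costs_def)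

end

section \<open>The isometry\<close>

text \<open>The identity serves as the isometry. Agreement of the norms on \<open>V\<close> is
  enough, as the axioms evaluate a norm only at members of \<open>V\<close>.\<close>

lemma isometrically_isomorphic_refl:
  assumes "normed_function_space X V N" "\<And>f. f \<in> V \<Longrightarrow> N' f = N f"
  shows "isometrically_isomorphic X V N V N'"
proof -
  have "normed_function_space X V N'"
    using assms unfolding normed_function_space_def by simp
  then show ?thesis
    unfolding isometrically_isomorphic_def using assms by (auto intro!: exI[of _ id])
qed

theorem theorem9:
  fixes X :: "(real^'d) set"
    and \<Omega> :: "((real^'d) \<times> real) set"
    and \<sigma> :: "real \<Rightarrow> real"
  assumes "compact X"
    and "closed \<Omega>"
    and "\<Omega> \<noteq> {}"
    and "continuous_on UNIV \<sigma>"
    and "compact \<Omega> \<or> \<sigma> \<in> O[at_infinity](\<lambda>y. y)"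
  shows "isometrically_isomorphic X
           (barron_space X \<Omega> \<sigma>) (barron_norm X \<Omega> \<sigma>)
           (rkbs X \<Omega> (barron_kernel \<sigma>)) (rkbs_norm X \<Omega> (barron_kernel \<sigma>))"
proof -
  \<comment> \<open>The bounds obtained for each \<open>x\<close> separately are turned into a
    function \<open>K\<close> by choice.\<close>
  obtain K where "\<And>x w. w \<in> \<Omega> \<Longrightarrow> \<bar>barron_kernel \<sigma> x w\<bar> \<le> K x"
    using barron_kernel_bounded[OF assms(4,5)] by metis
  then interpret barron X \<Omega> \<sigma> K
    using assms by unfold_locales auto
  show ?thesis
    unfolding barron_space_eq_rkbs
  proof (rule isometrically_isomorphic_refl)
    show "normed_function_space X (rkbs X \<Omega> (barron_kernel \<sigma>)) (barron_norm X \<Omega> \<sigma>)"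
      unfolding rkbs_eq barron_norm_eq[abs_def] by (rule normed_function_space_representation_costs)
  qed (simp add: barron_norm_eq rkbs_norm_eq)
qed

end
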